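(* Let $n\ge1$ be an integer, and for a positive integer $r$ let $\rho_r:\operatorname{Hank}_n^r(\mathbb{C})\rightarrow\mathbb{C}^{n\times n}$ be the map defined by $\rho_r(H_1,\dots,H_r)=H_1\cdots H_r$. If $r\ge\lfloor n/2\rfloor+1$, then $\rho_r$ is dominant. Therefore, for a generic $A\in\mathbb{C}^{n\times n}$, there exist $r=\lfloor n/2\rfloor+1$ Hankel matrices $H_1,\dots,H_r\in\operatorname{Hank}_n(\mathbb{C})$ such that $A=H_1\cdots H_r$.
   Context: $\operatorname{Hank}_n(\mathbb{C})\simeq\mathbb{C}^{2n-1}$ is the linear subspace of $\mathbb{C}^{n\times n}$ of Hankel matrices, i.e. matrices $(h_{ij})$ with $h_{ij}=h_{i'j'}$ whenever $i+j=i'+j'$. $\operatorname{Hank}_n^r(\mathbb{C})$ is the product of $r$ copies of $\operatorname{Hank}_n(\mathbb{C})$. A morphism is dominant if its image is Zariski dense in the target. A property holds for a generic $A\in\mathbb{C}^{n\times n}$ if the Zariski closure of the set of matrices not having the property is a proper closed subset of $\mathbb{C}^{n\times n}$. *)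

theory Defs
  imports Complex_Main "Jordan_Normal_Form.Matrix" "HOL-Library.Poly_Mapping"
begin

text \<open>
  A polynomial in the matrix entries is a finitely supported map from monomials to coefficients,
  a monomial being a finitely supported map from entry positions to exponents. Positions are
  0-based, as in \<^term>\<open>A $$ (i, j)\<close>.
\<close>

type_synonym entry_poly = "((nat \<times> nat) \<Rightarrow>\<^sub>0 nat) \<Rightarrow>\<^sub>0 complex"

text \<open>The polynomials in the \<open>n\<^sup>2\<close> entries of an \<open>n \<times> n\<close> matrix; other variables are excluded
  because \<^term>\<open>A $$ (i, j)\<close> is unspecified outside the dimensions of \<open>A\<close>.\<close>

definition entry_polys :: "nat \<Rightarrow> entry_poly set" where
  "entry_polys n = {p. \<forall>m \<in> Poly_Mapping.keys p. Poly_Mapping.keys m \<subseteq> {..<n} \<times> {..<n}}"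

definition eval_entries :: "entry_poly \<Rightarrow> complex mat \<Rightarrow> complex" where
  "eval_entries p A =
     (\<Sum>m \<in> Poly_Mapping.keys p. Poly_Mapping.lookup p m *
        (\<Prod>v \<in> Poly_Mapping.keys m. (A $$ v) ^ Poly_Mapping.lookup m v))"

definition zariski_closed :: "nat \<Rightarrow> complex mat set \<Rightarrow> bool" where
  "zariski_closed n Z \<longleftrightarrow>
     (\<exists>P \<subseteq> entry_polys n. Z = {A \<in> carrier_mat n n. \<forall>p \<in> P. eval_entries p A = 0})"

definition zariski_closure :: "nat \<Rightarrow> complex mat set \<Rightarrow> complex mat set" where
  "zariski_closure n S = zariski_closed n hull S"

definition dominant :: "nat \<Rightarrow> 'a set \<Rightarrow> ('a \<Rightarrow> complex mat) \<Rightarrow> bool" where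
  "dominant n X f \<longleftrightarrow> f ` X \<subseteq> carrier_mat n n \<and> zariski_closure n (f ` X) = carrier_mat n n"

definition generic :: "nat \<Rightarrow> (complex mat \<Rightarrow> bool) \<Rightarrow> bool" where
  "generic n P \<longleftrightarrow> zariski_closure n {A \<in> carrier_mat n n. \<not> P A} \<subset> carrier_mat n n"

definition Hank :: "nat \<Rightarrow> complex mat set" where
  "Hank n = {H \<in> carrier_mat n n.
     \<forall>i<n. \<forall>j<n. \<forall>i'<n. \<forall>j'<n. i + j = i' + j' \<longrightarrow> H $$ (i, j) = H $$ (i', j')}"

text \<open>The \<open>r\<close>-tuples \<open>(H\<^sub>1, \<dots>, H\<^sub>r)\<close> are lists of length \<open>r\<close>.\<close>

definition Hank_tuples :: "nat \<Rightarrow> nat \<Rightarrow> complex mat list set" where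
  "Hank_tuples n r = {Hs. length Hs = r \<and> set Hs \<subseteq> Hank n}"

definition rho :: "nat \<Rightarrow> complex mat list \<Rightarrow> complex mat" where
  "rho n Hs = foldr (*) Hs (1\<^sub>m n)"

end

theory Submission
  imports Defs "HOL-Analysis.Path_Connected" "HOL-Analysis.Function_Topology"
    "Jordan_Normal_Form.Determinant"
begin

text \<open>
The product map is polynomial, and everything rests on one point at which its differential is
surjective. Restricting to an affine subspace of dimension \<open>n\<^sup>2\<close> through that point turns it into a
polynomial map from \<open>\<complex>\<^sup>N\<close> to \<open>\<complex>\<^sup>N\<close>, \<open>N = n\<^sup>2\<close>, with nonsingular differential there, and such a map is
surjective outside the zero set of some nonzero polynomial (\<open>nonsingular_polymap_generically_surj\<close>).
So the image contains a nonempty principal Zariski open set \<open>{Q \<noteq> 0}\<close>, which gives density as well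
as the statement about generic matrices.

Generic surjectivity is shown without elimination theory. Counting monomials shows that
each coordinate of \<open>x\<close>, and also the Jacobian determinant \<open>J x\<close>, satisfies an algebraic equation
with coefficients in \<open>g x\<close> (\<open>algebraically_dependent\<close>). Let \<open>Q\<close> be the product of the leading
coefficients of the equations for the coordinates and of the constant coefficient of the equation
for \<open>J\<close>. Over a compact part of \<open>{Q \<noteq> 0}\<close> the fibres of \<open>g\<close> are uniformly bounded, so the image is
closed in \<open>{Q \<noteq> 0}\<close>; and \<open>J\<close> has no zero on the fibres, so the image is open there
(\<open>polymap_locally_surj\<close>). A complex line meets \<open>{Q \<noteq> 0}\<close> in the complement of a finite set, which is
connected, so the image contains all of \<open>{Q \<noteq> 0}\<close>.

To find the point, let \<open>J\<close> now denote the exchange matrix, with ones on the antidiagonal. A Toeplitz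
matrix times \<open>J\<close>, on either side, is Hankel, and \<open>J\<^sup>2 = 1\<close>, so that \<open>S\<^sub>1 \<cdots> S\<^sub>r J\<^sup>r\<close> is a product of \<open>r\<close>
Hankel matrices for all Toeplitz matrices \<open>S\<^sub>1, \<dots>, S\<^sub>r\<close>. It remains to study
products of Toeplitz matrices near \<open>1 + \<epsilon> E\<^sub>0, \<dots>, 1 + \<epsilon> E\<^bsub>k-1\<^esub>, 1\<close>, where \<open>k = \<lfloor>n/2\<rfloor>\<close>. In directions
that cancel at \<open>\<epsilon> = 0\<close> the differential is \<open>\<epsilon>\<close> times a polynomial in \<open>\<epsilon>\<close> whose constant term is
\<open>W + \<Sum>\<^sub>j (Z\<^sub>j E\<^sub>j - E\<^sub>j Z\<^bsub>j+1\<^esub>)\<close> with \<open>W\<close>, \<open>Z\<^sub>1, \<dots>, Z\<^sub>k\<close> arbitrary Toeplitz matrices and \<open>Z\<^sub>0 = 0\<close>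
(\<open>perturbed_derivative\<close>). For well chosen \<open>E\<^sub>j\<close> these expressions are all the \<open>n \<times> n\<close> matrices
(\<open>toeplitz_commutator_decomposition\<close>), hence the differential is surjective for all but
finitely many \<open>\<epsilon>\<close>.
\<close>

section \<open>Polynomial functions\<close>

text \<open>
Points are total functions on the type of the variables, so that no type has to depend on the
number of variables; a polynomial function in the variables \<open>V\<close> ignores all other coordinates.
\<close>

inductive_set polyfun :: "'v set \<Rightarrow> (('v \<Rightarrow> complex) \<Rightarrow> complex) set" for V :: "'v set" where
  const: "(\<lambda>_. c) \<in> polyfun V"
| var: "v \<in> V \<Longrightarrow> (\<lambda>x. x v) \<in> polyfun V"
| add: "p \<in> polyfun V \<Longrightarrow> q \<in> polyfun V \<Longrightarrow> (\<lambda>x. p x + q x) \<in> polyfun V"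
| mult: "p \<in> polyfun V \<Longrightarrow> q \<in> polyfun V \<Longrightarrow> (\<lambda>x. p x * q x) \<in> polyfun V"

lemma polyfun_sum: "(\<And>i. i \<in> I \<Longrightarrow> p i \<in> polyfun V) \<Longrightarrow> (\<lambda>x. \<Sum>i\<in>I. p i x) \<in> polyfun V"
  by (induction I rule: infinite_finite_induct) (auto intro: polyfun.intros)

lemma polyfun_prod: "(\<And>i. i \<in> I \<Longrightarrow> p i \<in> polyfun V) \<Longrightarrow> (\<lambda>x. \<Prod>i\<in>I. p i x) \<in> polyfun V"
  by (induction I rule: infinite_finite_induct) (auto intro: polyfun.intros)

lemma polyfun_power: "p \<in> polyfun V \<Longrightarrow> (\<lambda>x. p x ^ k) \<in> polyfun V"
  by (induction k) (auto intro: polyfun.intros)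

lemma polyfun_subst:
  assumes "p \<in> polyfun V" and "\<And>v. v \<in> V \<Longrightarrow> g v \<in> polyfun W"
  shows "(\<lambda>x. p (\<lambda>v. g v x)) \<in> polyfun W"
  using assms(1) by induction (auto intro: polyfun.intros assms(2))

lemma polyfun_cong:
  assumes "p \<in> polyfun V" and "\<And>v. v \<in> V \<Longrightarrow> x v = y v"
  shows "p x = p y"
  using assms(1) by induction (auto simp: assms(2))

lemma polyfun_on_line:
  assumes "p \<in> polyfun V"
  shows "\<exists>P. \<forall>s. p (\<lambda>v. a v + s * d v) = poly P s"
  using assms
proof induction
  case (const c)
  show ?case by (rule exI[of _ "[:c:]"]) simp
next
  case (var v)
  show ?case by (rule exI[of _ "[:a v, d v:]"]) simp
next
  case (add p q)
  then obtain P Q where "\<forall>s. p (\<lambda>v. a v + s * d v) = poly P s" "\<forall>s. q (\<lambda>v. a v + s * d v) = poly Q s"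
    by blast
  then show ?case by (intro exI[of _ "P + Q"]) simp
next
  case (mult p q)
  then obtain P Q where "\<forall>s. p (\<lambda>v. a v + s * d v) = poly P s" "\<forall>s. q (\<lambda>v. a v + s * d v) = poly Q s"
    by blast
  then show ?case by (intro exI[of _ "P * Q"]) simp
qed

lemma polyfun_on_line_nonzero:
  assumes "p \<in> polyfun V" and "p x \<noteq> 0"
  shows "\<exists>P. P \<noteq> 0 \<and> (\<forall>s. p (\<lambda>v. a v + s * (x v - a v)) = poly P s)"
proof -
  obtain P where P: "\<And>s. p (\<lambda>v. a v + s * (x v - a v)) = poly P s"
    using polyfun_on_line[OF assms(1), of a "\<lambda>v. x v - a v"] by blast
  have "poly P 1 \<noteq> 0" using P[of 1] assms(2) by simp
  then have "P \<noteq> 0" by auto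
  then show ?thesis using P by blast
qed

text \<open>
Polynomial functions form an integral domain: on the line through a non-zero of \<open>p\<close> and a non-zero
of \<open>q\<close> both are nonzero polynomials in one variable.
\<close>

lemma polyfun_mult_nonzero:
  assumes "p \<in> polyfun V" "q \<in> polyfun V" "p x \<noteq> 0" "q y \<noteq> 0"
  shows "\<exists>z. p z * q z \<noteq> 0"
proof -
  obtain P where P: "P \<noteq> 0" "\<And>s. p (\<lambda>v. y v + s * (x v - y v)) = poly P s"
    using polyfun_on_line_nonzero[of p V x y] assms(1,3) by blast
  obtain Q where Q: "\<And>s. q (\<lambda>v. y v + s * (x v - y v)) = poly Q s"
    using polyfun_on_line[OF assms(2), of y "\<lambda>v. x v - y v"] by blast
  have "poly Q 0 \<noteq> 0" using Q[of 0] assms(4) by simp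
  then have "P * Q \<noteq> 0" using P(1) by auto
  then obtain s where "poly (P * Q) s \<noteq> 0" using poly_all_0_iff_0 by blast
  then have "p (\<lambda>v. y v + s * (x v - y v)) * q (\<lambda>v. y v + s * (x v - y v)) \<noteq> 0"
    unfolding P(2) Q poly_mult .
  then show ?thesis by blast
qed

lemma polyfun_prod_nonzero:
  assumes "finite I" and "\<And>i. i \<in> I \<Longrightarrow> p i \<in> polyfun V" and "\<And>i. i \<in> I \<Longrightarrow> \<exists>x. p i x \<noteq> 0"
  shows "\<exists>x. (\<Prod>i\<in>I. p i x) \<noteq> 0"
  using assms
proof (induction I rule: finite_induct)
  case (insert i I)
  then obtain x y where "p i x \<noteq> 0" "(\<Prod>i\<in>I. p i y) \<noteq> 0" by blast
  moreover have "p i \<in> polyfun V" "(\<lambda>x. \<Prod>i\<in>I. p i x) \<in> polyfun V"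
    using insert.prems by (auto intro: polyfun_prod)
  ultimately have "\<exists>z. p i z * (\<Prod>i\<in>I. p i z) \<noteq> 0"
    by (rule polyfun_mult_nonzero[rotated 2])
  then show ?case using insert.hyps by simp
qed simp

lemma polyfun_continuous:
  "p \<in> polyfun V \<Longrightarrow> continuous_on UNIV p"
  by (induction rule: polyfun.induct) (auto intro!: continuous_intros continuous_on_product_coordinates)

text \<open>
Joint continuity with respect to the coordinates in \<open>V\<close> only; it is preserved by all operations
that build difference quotients of polynomial functions.
\<close>

definition coordwise_cont :: "'v set \<Rightarrow> (('v \<Rightarrow> complex) \<Rightarrow> ('v \<Rightarrow> complex) \<Rightarrow> complex) \<Rightarrow> bool" where
  "coordwise_cont V q \<longleftrightarrow> (\<forall>X Y x y. (\<forall>v\<in>V. (\<lambda>i::nat. X i v) \<longlonglongrightarrow> x v) \<longrightarrow> (\<forall>v\<in>V. (\<lambda>i. Y i v) \<longlonglongrightarrow> y v)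
     \<longrightarrow> (\<lambda>i. q (X i) (Y i)) \<longlonglongrightarrow> q x y)"

lemma polyfun_tendsto:
  assumes "p \<in> polyfun V" and "\<And>v. v \<in> V \<Longrightarrow> ((\<lambda>i. X i v) \<longlongrightarrow> x v) F"
  shows "((\<lambda>i. p (X i)) \<longlongrightarrow> p x) F"
  using assms(1) by induction (auto intro!: tendsto_intros assms(2))

text \<open>
This replaces differential calculus: an exact first order expansion with continuous
coefficients. On the diagonal the coefficients are the partial derivatives.
\<close>

lemma polyfun_difference_quotient:
  assumes "finite V" and "p \<in> polyfun V"
  shows "\<exists>q. (\<forall>w\<in>V. coordwise_cont V (q w) \<and> (\<lambda>x. q w x x) \<in> polyfun V) \<and>
             (\<forall>x y. p x - p y = (\<Sum>w\<in>V. q w x y * (x w - y w)))"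
  using assms(2)
proof induction
  case (const c)
  show ?case
    by (rule exI[of _ "\<lambda>w x y. 0"]) (auto simp: coordwise_cont_def intro: polyfun.intros)
next
  case (var v)
  have "(\<Sum>w\<in>V. (if w = v then 1 else 0) * (x w - y w)) = x v - y v" for x y :: "'a \<Rightarrow> complex"
    using var assms(1) by (simp add: if_distrib[of "\<lambda>c. c * _"] cong: if_cong)
  then show ?case
    by (intro exI[of _ "\<lambda>w x y. if w = v then 1 else 0"])
       (auto simp: coordwise_cont_def intro: polyfun.intros)
next
  case (add p1 p2)
  obtain q1 where q1: "\<forall>w\<in>V. coordwise_cont V (q1 w) \<and> (\<lambda>x. q1 w x x) \<in> polyfun V"
      "\<forall>x y. p1 x - p1 y = (\<Sum>w\<in>V. q1 w x y * (x w - y w))"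
    using add.IH(1) by blast
  obtain q2 where q2: "\<forall>w\<in>V. coordwise_cont V (q2 w) \<and> (\<lambda>x. q2 w x x) \<in> polyfun V"
      "\<forall>x y. p2 x - p2 y = (\<Sum>w\<in>V. q2 w x y * (x w - y w))"
    using add.IH(2) by blast
  show ?case
  proof (intro exI[of _ "\<lambda>w x y. q1 w x y + q2 w x y"] conjI ballI allI)
    fix w assume "w \<in> V"
    then show "coordwise_cont V (\<lambda>x y. q1 w x y + q2 w x y)"
      using q1(1) q2(1) unfolding coordwise_cont_def by (auto intro!: tendsto_add)
    show "(\<lambda>x. q1 w x x + q2 w x x) \<in> polyfun V"
      using q1(1) q2(1) \<open>w \<in> V\<close> by (intro polyfun.intros) auto
  next
    fix x y
    have "p1 x + p2 x - (p1 y + p2 y) = (p1 x - p1 y) + (p2 x - p2 y)" by simp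
    then show "p1 x + p2 x - (p1 y + p2 y) = (\<Sum>w\<in>V. (q1 w x y + q2 w x y) * (x w - y w))"
      unfolding q1(2)[rule_format] q2(2)[rule_format] by (simp add: sum.distrib distrib_right)
  qed
next
  case (mult p1 p2)
  obtain q1 where q1: "\<forall>w\<in>V. coordwise_cont V (q1 w) \<and> (\<lambda>x. q1 w x x) \<in> polyfun V"
      "\<forall>x y. p1 x - p1 y = (\<Sum>w\<in>V. q1 w x y * (x w - y w))"
    using mult.IH(1) by blast
  obtain q2 where q2: "\<forall>w\<in>V. coordwise_cont V (q2 w) \<and> (\<lambda>x. q2 w x x) \<in> polyfun V"
      "\<forall>x y. p2 x - p2 y = (\<Sum>w\<in>V. q2 w x y * (x w - y w))"
    using mult.IH(2) by blast
  show ?case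
  proof (intro exI[of _ "\<lambda>w x y. p1 x * q2 w x y + p2 y * q1 w x y"] conjI ballI allI)
    fix w assume w: "w \<in> V"
    show "coordwise_cont V (\<lambda>x y. p1 x * q2 w x y + p2 y * q1 w x y)"
      unfolding coordwise_cont_def
    proof (intro allI impI)
      fix X Y :: "nat \<Rightarrow> 'a \<Rightarrow> complex" and x y
      assume X: "\<forall>v\<in>V. (\<lambda>i. X i v) \<longlonglongrightarrow> x v" and Y: "\<forall>v\<in>V. (\<lambda>i. Y i v) \<longlonglongrightarrow> y v"
      have "(\<lambda>i. p1 (X i)) \<longlonglongrightarrow> p1 x" "(\<lambda>i. p2 (Y i)) \<longlonglongrightarrow> p2 y"
        using X Y polyfun_tendsto mult.hyps by blast+
      moreover have "(\<lambda>i. q1 w (X i) (Y i)) \<longlonglongrightarrow> q1 w x y" "(\<lambda>i. q2 w (X i) (Y i)) \<longlonglongrightarrow> q2 w x y"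
        using X Y bspec[OF q1(1) w] bspec[OF q2(1) w] unfolding coordwise_cont_def by blast+
      ultimately show "(\<lambda>i. p1 (X i) * q2 w (X i) (Y i) + p2 (Y i) * q1 w (X i) (Y i)) \<longlonglongrightarrow> p1 x * q2 w x y + p2 y * q1 w x y"
        by (intro tendsto_intros)
    qed
    show "(\<lambda>x. p1 x * q2 w x x + p2 x * q1 w x x) \<in> polyfun V"
      using q1(1) q2(1) w mult.hyps by (intro polyfun.intros) auto
  next
    fix x y
    have "p1 x * p2 x - p1 y * p2 y = p1 x * (p2 x - p2 y) + p2 y * (p1 x - p1 y)"
      by (simp add: algebra_simps)
    also have "\<dots> = (\<Sum>w\<in>V. (p1 x * q2 w x y + p2 y * q1 w x y) * (x w - y w))"
      unfolding q1(2)[rule_format] q2(2)[rule_format] by (simp add: sum_distrib_left sum.distrib[symmetric] algebra_simps)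
    finally show "p1 x * p2 x - p1 y * p2 y = (\<Sum>w\<in>V. (p1 x * q2 w x y + p2 y * q1 w x y) * (x w - y w))" .
  qed
qed

lemma coordwise_cont_uniform:
  assumes "coordwise_cont V q" and "\<eta> > 0"
  shows "\<exists>\<delta>>0. \<forall>x y. (\<forall>v\<in>V. norm (x v - x0 v) \<le> \<delta> \<and> norm (y v - x0 v) \<le> \<delta>) \<longrightarrow> norm (q x y - q x0 x0) < \<eta>"
proof (rule ccontr)
  assume neg: "\<not> ?thesis"
  define bad where "bad i z \<longleftrightarrow> (\<forall>v\<in>V. norm (fst z v - x0 v) \<le> inverse (real (Suc i))
      \<and> norm (snd z v - x0 v) \<le> inverse (real (Suc i))) \<and> \<not> norm (q (fst z) (snd z) - q x0 x0) < \<eta>"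
    for i :: nat and z
  have "\<exists>z. bad i z" for i
  proof -
    have "inverse (real (Suc i)) > 0" by simp
    then obtain x y where "(\<forall>v\<in>V. norm (x v - x0 v) \<le> inverse (real (Suc i))
        \<and> norm (y v - x0 v) \<le> inverse (real (Suc i)))" "\<not> norm (q x y - q x0 x0) < \<eta>"
      using neg by blast
    then have "bad i (x, y)" unfolding bad_def by simp
    then show ?thesis by blast
  qed
  then obtain Z where Z: "\<And>i. bad i (Z i)" using choice[of bad] by blast
  define X Y where "X i = fst (Z i)" and "Y i = snd (Z i)" for i
  have XY: "\<And>i v. v \<in> V \<Longrightarrow> norm (X i v - x0 v) \<le> inverse (Suc i)"
      "\<And>i v. v \<in> V \<Longrightarrow> norm (Y i v - x0 v) \<le> inverse (Suc i)"
      "\<And>i::nat. \<not> norm (q (X i) (Y i) - q x0 x0) < \<eta>"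
    using Z unfolding bad_def X_def Y_def by blast+
  have lim: "\<forall>v\<in>V. (\<lambda>i. T i v) \<longlonglongrightarrow> x0 v"
    if T: "\<And>i v. v \<in> V \<Longrightarrow> norm (T i v - x0 v) \<le> inverse (real (Suc i))"
    for T :: "nat \<Rightarrow> 'a \<Rightarrow> complex"
  proof
    fix v assume "v \<in> V"
    show "(\<lambda>i. T i v) \<longlonglongrightarrow> x0 v"
    proof (rule LIM_zero_cancel, rule Lim_null_comparison[OF _ LIMSEQ_inverse_real_of_nat])
      show "\<forall>\<^sub>F i in sequentially. norm (T i v - x0 v) \<le> inverse (real (Suc i))"
        using T[OF \<open>v \<in> V\<close>] by simp
    qed
  qed
  have "(\<lambda>i. q (X i) (Y i)) \<longlonglongrightarrow> q x0 x0"
    by (rule assms(1)[unfolded coordwise_cont_def, rule_format, of X x0 Y x0])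
      (rule lim[rule_format], (rule XY; assumption), assumption)+
  then have "\<forall>\<^sub>F i in sequentially. dist (q (X i) (Y i)) (q x0 x0) < \<eta>"
    using assms(2) by (rule tendstoD)
  then obtain i where "dist (q (X i) (Y i)) (q x0 x0) < \<eta>"
    using eventually_happens'[OF sequentially_bot] by blast
  then show False using XY(3)[of i] by (simp add: dist_norm)
qed

section \<open>Local surjectivity at a nondegenerate point\<close>

definition mutually_inverse :: "'v set \<Rightarrow> ('v \<Rightarrow> 'v \<Rightarrow> complex) \<Rightarrow> ('v \<Rightarrow> 'v \<Rightarrow> complex) \<Rightarrow> bool" where
  "mutually_inverse V A B \<longleftrightarrow> (\<forall>v\<in>V. \<forall>w\<in>V.
     (\<Sum>u\<in>V. A v u * B u w) = (if v = w then 1 else 0) \<and>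
     (\<Sum>u\<in>V. B v u * A u w) = (if v = w then 1 else 0))"

lemma mutually_inverse_sym: "mutually_inverse V A B \<Longrightarrow> mutually_inverse V B A"
  unfolding mutually_inverse_def by simp

lemma mutually_inverse_apply:
  assumes "finite V" "mutually_inverse V A B" "v \<in> V"
  shows "(\<Sum>w\<in>V. A v w * (\<Sum>u\<in>V. B w u * e u)) = e v"
proof -
  have "(\<Sum>w\<in>V. A v w * (\<Sum>u\<in>V. B w u * e u)) = (\<Sum>u\<in>V. (\<Sum>w\<in>V. A v w * B w u) * e u)"
    unfolding sum_distrib_left sum_distrib_right by (subst sum.swap) (simp add: mult.assoc)
  also have "\<dots> = (\<Sum>u\<in>V. (if v = u then 1 else 0) * e u)"
    using assms(2,3) unfolding mutually_inverse_def by (intro sum.cong) auto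
  also have "\<dots> = e v"
    using assms(1,3) by (simp add: if_distrib[of "\<lambda>c. c * _"] cong: if_cong)
  finally show ?thesis .
qed

lemma l1_matrix_bound:
  fixes A :: "'v \<Rightarrow> 'v \<Rightarrow> complex" and b :: real
  assumes "\<And>v w. v \<in> V \<Longrightarrow> w \<in> V \<Longrightarrow> norm (A v w) \<le> b"
  shows "(\<Sum>v\<in>V. norm (\<Sum>w\<in>V. A v w * h w)) \<le> card V * b * (\<Sum>w\<in>V. norm (h w))"
proof -
  have "norm (\<Sum>w\<in>V. A v w * h w) \<le> b * (\<Sum>w\<in>V. norm (h w))" if "v \<in> V" for v
    unfolding sum_distrib_left
    by (rule sum_norm_le) (use assms that in \<open>auto simp: norm_mult intro!: mult_right_mono\<close>)
  then have "(\<Sum>v\<in>V. norm (\<Sum>w\<in>V. A v w * h w)) \<le> (\<Sum>v\<in>V. b * (\<Sum>w\<in>V. norm (h w)))"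
    by (rule sum_mono)
  then show ?thesis by simp
qed

lemma compact_box:
  "compact {x :: 'v \<Rightarrow> complex. \<forall>v. x v \<in> cball (a v) (R v)}"
proof -
  have "compactin (product_topology (\<lambda>_. euclidean) UNIV) (PiE UNIV (\<lambda>v. cball (a v) (R v)))"
    by (subst compactin_PiE) auto
  also have "PiE UNIV (\<lambda>v. cball (a v) (R v)) = {x. \<forall>v. x v \<in> cball (a v) (R v)}" by auto
  finally show ?thesis unfolding euclidean_product_topology by simp
qed

lemma compact_l1_ball:
  fixes x0 :: "'v \<Rightarrow> complex"
  assumes "finite V"
  shows "compact {x. (\<forall>v. v \<notin> V \<longrightarrow> x v = x0 v) \<and> (\<Sum>v\<in>V. norm (x v - x0 v)) \<le> \<delta>}"
proof -
  let ?box = "{x. \<forall>v. x v \<in> cball (x0 v) (if v \<in> V then \<delta> else 0)}"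
  have "closed {x. (\<Sum>v\<in>V. norm (x v - x0 v)) \<le> \<delta>}"
    by (intro closed_Collect_le continuous_intros continuous_on_product_coordinates)
  then have "compact (?box \<inter> {x. (\<Sum>v\<in>V. norm (x v - x0 v)) \<le> \<delta>})"
    by (intro compact_Int_closed compact_box)
  also have "?box \<inter> {x. (\<Sum>v\<in>V. norm (x v - x0 v)) \<le> \<delta>}
      = {x. (\<forall>v. v \<notin> V \<longrightarrow> x v = x0 v) \<and> (\<Sum>v\<in>V. norm (x v - x0 v)) \<le> \<delta>}"
  proof (rule Set.set_eqI, rule iffI)
    fix x assume x: "x \<in> {x. (\<forall>v. v \<notin> V \<longrightarrow> x v = x0 v) \<and> (\<Sum>v\<in>V. norm (x v - x0 v)) \<le> \<delta>}"
    have "norm (x v - x0 v) \<le> \<delta>" if "v \<in> V" for v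
    proof -
      have "norm (x v - x0 v) \<le> (\<Sum>v\<in>V. norm (x v - x0 v))"
        by (rule member_le_sum) (use assms that in auto)
      with x show ?thesis by simp
    qed
    with x show "x \<in> ?box \<inter> {x. (\<Sum>v\<in>V. norm (x v - x0 v)) \<le> \<delta>}"
      by (auto simp: dist_norm norm_minus_commute)
  next
    fix x assume x: "x \<in> ?box \<inter> {x. (\<Sum>v\<in>V. norm (x v - x0 v)) \<le> \<delta>}"
    then have box: "x v \<in> cball (x0 v) (if v \<in> V then \<delta> else 0)" for v by blast
    have "x v = x0 v" if "v \<notin> V" for v using box[of v] that by simp
    with x show "x \<in> {x. (\<forall>v. v \<notin> V \<longrightarrow> x v = x0 v) \<and> (\<Sum>v\<in>V. norm (x v - x0 v)) \<le> \<delta>}"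
      by blast
  qed
  finally show ?thesis .
qed

text \<open>
For \<open>y\<close> close to \<open>g x0\<close>, a Newton step with the inverse \<open>C\<close> of the differential at \<open>x0\<close> stays inside a small ball and halves
the error \<open>\<Sum>\<^sub>v \<bar>y v - g v x\<bar>\<close>. The error attains its minimum on the compact ball, and at a
minimum it therefore vanishes.
\<close>

lemma polymap_locally_surj:
  fixes g :: "'v \<Rightarrow> ('v \<Rightarrow> complex) \<Rightarrow> complex"
  assumes fin: "finite V"
    and g: "\<And>v. v \<in> V \<Longrightarrow> g v \<in> polyfun V"
    and qc: "\<And>v w. v \<in> V \<Longrightarrow> w \<in> V \<Longrightarrow> coordwise_cont V (q v w)"
    and q: "\<And>v x y. v \<in> V \<Longrightarrow> g v x - g v y = (\<Sum>w\<in>V. q v w x y * (x w - y w))"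
    and inv: "mutually_inverse V (\<lambda>v w. q v w x0 x0) C"
  shows "\<exists>\<epsilon>>0. \<forall>y. (\<Sum>v\<in>V. norm (y v - g v x0)) < \<epsilon> \<longrightarrow> (\<exists>x. \<forall>v\<in>V. g v x = y v)"
proof -
  define D where "D v w = q v w x0 x0" for v w
  define b where "b = (\<Sum>v\<in>V. \<Sum>w\<in>V. norm (C v w))"
  have Cb: "norm (C v w) \<le> b" if "v \<in> V" "w \<in> V" for v w
  proof -
    have "norm (C v w) \<le> (\<Sum>w\<in>V. norm (C v w))"
      using that fin by (intro member_le_sum[of w V "\<lambda>w. norm (C v w)"]) simp_all
    also have "\<dots> \<le> b" unfolding b_def
      using that fin by (intro member_le_sum[of v V "\<lambda>v. \<Sum>w\<in>V. norm (C v w)"] sum_nonneg norm_ge_zero)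
    finally show ?thesis .
  qed
  have b0: "b \<ge> 0" unfolding b_def by (intro sum_nonneg) auto
  define c where "c = card V * b + 1"
  have c: "c \<ge> 1" using b0 by (simp add: c_def)
  have Cc: "(\<Sum>v\<in>V. norm (\<Sum>w\<in>V. C v w * h w)) \<le> c * (\<Sum>w\<in>V. norm (h w))" for h
  proof -
    have "(\<Sum>v\<in>V. norm (\<Sum>w\<in>V. C v w * h w)) \<le> card V * b * (\<Sum>w\<in>V. norm (h w))"
      by (rule l1_matrix_bound[of V C b h]) (rule Cb)
    also have "\<dots> \<le> c * (\<Sum>w\<in>V. norm (h w))"
      by (intro mult_right_mono sum_nonneg norm_ge_zero) (simp add: c_def)
    finally show ?thesis .
  qed
  \<comment> \<open>With this bound on the entries of \<open>q - D\<close>, applying \<open>q - D\<close> and then \<open>C\<close> at least halves the l1-norm.\<close>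
  define \<eta> where "\<eta> = 1 / (2 * c * (card V + 1))"
  have \<eta>: "\<eta> > 0" using c by (simp add: \<eta>_def)
  have c\<eta>: "c * (card V * \<eta>) \<le> 1/2"
  proof -
    have "c * (card V * \<eta>) = (c * card V) / (c * (2 * (real (card V) + 1)))"
      unfolding \<eta>_def by (simp add: mult_ac)
    also have "\<dots> = card V / (2 * (real (card V) + 1))"
      using c by (intro mult_divide_mult_cancel_left) simp
    also have "\<dots> \<le> 1/2" by (subst divide_le_eq) simp
    finally show ?thesis .
  qed
  define good where "good \<delta> v w \<longleftrightarrow> (\<forall>x y. (\<forall>u\<in>V. norm (x u - x0 u) \<le> \<delta> \<and> norm (y u - x0 u) \<le> \<delta>)
      \<longrightarrow> norm (q v w x y - D v w) < \<eta>)" for \<delta> :: real and v w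
  define d :: "'v \<Rightarrow> 'v \<Rightarrow> real" where "d v w = (SOME d. d > 0 \<and> good d v w)" for v w
  have d: "d v w > 0 \<and> good (d v w) v w" if "v \<in> V" "w \<in> V" for v w
  proof -
    have "\<exists>d. d > 0 \<and> good d v w"
      unfolding good_def D_def by (rule coordwise_cont_uniform[OF qc[OF that] \<eta>])
    then show ?thesis unfolding d_def by (rule someI_ex)
  qed
  define \<delta> where "\<delta> = Min (insert 1 ((\<lambda>(v, w). d v w) ` (V \<times> V)))"
  have \<delta>: "\<delta> > 0" unfolding \<delta>_def using fin d by (subst Min_gr_iff) auto
  have \<delta>d: "\<delta> \<le> d v w" if "v \<in> V" "w \<in> V" for v w
    unfolding \<delta>_def using fin that by (intro Min_le) auto
  define B where "B = {x. (\<forall>v. v \<notin> V \<longrightarrow> x v = x0 v) \<and> (\<Sum>v\<in>V. norm (x v - x0 v)) \<le> \<delta>}"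
  have Bv: "norm (x v - x0 v) \<le> \<delta>" if "x \<in> B" "v \<in> V" for x v
  proof -
    have "norm (x v - x0 v) \<le> (\<Sum>v\<in>V. norm (x v - x0 v))"
      by (rule member_le_sum) (use fin that in auto)
    then show ?thesis using that(1) by (simp add: B_def)
  qed
  have x0B: "x0 \<in> B" using \<delta> by (simp add: B_def)
  have qD: "norm (q v w x y - D v w) \<le> \<eta>" if "x \<in> B" "y \<in> B" "v \<in> V" "w \<in> V" for x y v w
  proof -
    have "norm (x u - x0 u) \<le> d v w \<and> norm (y u - x0 u) \<le> d v w" if "u \<in> V" for u
      using Bv[OF \<open>x \<in> B\<close> that] Bv[OF \<open>y \<in> B\<close> that] \<delta>d[OF \<open>v \<in> V\<close> \<open>w \<in> V\<close>] by linarith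
    moreover have "good (d v w) v w" using d[OF \<open>v \<in> V\<close> \<open>w \<in> V\<close>] by blast
    ultimately have "norm (q v w x y - D v w) < \<eta>" unfolding good_def by blast
    then show ?thesis by simp
  qed
  have qD1: "c * (\<Sum>v\<in>V. norm (\<Sum>w\<in>V. (q v w x y - D v w) * h w)) \<le> 1/2 * (\<Sum>w\<in>V. norm (h w))"
    if "x \<in> B" "y \<in> B" for x y h
  proof -
    have "c * (\<Sum>v\<in>V. norm (\<Sum>w\<in>V. (q v w x y - D v w) * h w)) \<le> c * (card V * \<eta> * (\<Sum>w\<in>V. norm (h w)))"
    proof (rule mult_left_mono)
      show "(\<Sum>v\<in>V. norm (\<Sum>w\<in>V. (q v w x y - D v w) * h w)) \<le> card V * \<eta> * (\<Sum>w\<in>V. norm (h w))"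
        by (rule l1_matrix_bound[of V "\<lambda>v w. q v w x y - D v w" \<eta> h]) (rule qD[OF that])
    qed (use c in simp)
    also have "\<dots> = (c * (card V * \<eta>)) * (\<Sum>w\<in>V. norm (h w))" by simp
    also have "\<dots> \<le> 1/2 * (\<Sum>w\<in>V. norm (h w))"
      by (rule mult_right_mono[OF c\<eta>]) (intro sum_nonneg norm_ge_zero)
    finally show ?thesis .
  qed
  show ?thesis
  proof (intro exI[of _ "\<delta> / (2 * c)"] conjI allI impI)
    show "\<delta> / (2 * c) > 0" using \<delta> c by simp
    fix y assume y: "(\<Sum>v\<in>V. norm (y v - g v x0)) < \<delta> / (2 * c)"
    have "continuous_on B (\<lambda>x. \<Sum>v\<in>V. norm (y v - g v x))"
      by (intro continuous_intros continuous_on_subset[OF polyfun_continuous[OF g]]) auto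
    moreover have "compact B" unfolding B_def by (rule compact_l1_ball[OF fin])
    ultimately obtain x where xB: "x \<in> B"
      and xmin: "\<And>z. z \<in> B \<Longrightarrow> (\<Sum>v\<in>V. norm (y v - g v x)) \<le> (\<Sum>v\<in>V. norm (y v - g v z))"
      using continuous_attains_inf[of B "\<lambda>x. \<Sum>v\<in>V. norm (y v - g v x)"] x0B by blast
    define e where "e v = y v - g v x" for v
    define h where "h w = (\<Sum>v\<in>V. C w v * e v)" for w
    define x' where "x' w = (if w \<in> V then x w + h w else x w)" for w
    define k where "k w = x w - x0 w" for w
    \<comment> \<open>The Newton step maps \<open>k = x - x0\<close> to \<open>C (y - g x0) - C (q - D) k\<close>, which is small.\<close>
    have x'B: "x' \<in> B"
    proof -
      have eq: "x' w - x0 w = (\<Sum>v\<in>V. C w v * (y v - g v x0))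
          - (\<Sum>v\<in>V. C w v * (\<Sum>u\<in>V. (q v u x x0 - D v u) * k u))" if w: "w \<in> V" for w
      proof -
        have "(\<Sum>u\<in>V. (q v u x x0 - D v u) * k u) = (g v x - g v x0) - (\<Sum>u\<in>V. D v u * k u)"
          if "v \<in> V" for v
          unfolding q[OF that] k_def by (simp add: sum_subtractf left_diff_distrib)
        then have "(\<Sum>v\<in>V. C w v * (\<Sum>u\<in>V. (q v u x x0 - D v u) * k u))
            = (\<Sum>v\<in>V. C w v * (g v x - g v x0)) - (\<Sum>v\<in>V. C w v * (\<Sum>u\<in>V. D v u * k u))"
          by (simp add: right_diff_distrib sum_subtractf)
        also have "(\<Sum>v\<in>V. C w v * (\<Sum>u\<in>V. D v u * k u)) = k w"
          by (rule mutually_inverse_apply[OF fin mutually_inverse_sym w]) (use inv in \<open>simp add: D_def\<close>)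
        finally show ?thesis using w
          by (simp add: x'_def h_def e_def k_def right_diff_distrib sum_subtractf)
      qed
      have "(\<Sum>w\<in>V. norm (x' w - x0 w)) \<le> (\<Sum>w\<in>V. norm (\<Sum>v\<in>V. C w v * (y v - g v x0)))
          + (\<Sum>w\<in>V. norm (\<Sum>v\<in>V. C w v * (\<Sum>u\<in>V. (q v u x x0 - D v u) * k u)))"
        unfolding sum.distrib[symmetric] by (rule sum_mono) (simp only: eq norm_triangle_ineq4)
      also have "\<dots> \<le> c * (\<Sum>v\<in>V. norm (y v - g v x0))
          + c * (\<Sum>v\<in>V. norm (\<Sum>u\<in>V. (q v u x x0 - D v u) * k u))"
        by (intro add_mono Cc)
      also have "\<dots> \<le> \<delta> / 2 + 1/2 * (\<Sum>w\<in>V. norm (k w))"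
        by (intro add_mono qD1 xB x0B) (use y c in \<open>simp add: field_simps\<close>)
      also have "\<dots> \<le> \<delta>" using xB by (simp add: B_def k_def)
      finally show ?thesis using xB by (simp add: B_def x'_def)
    qed
    have "y v - g v x' = - (\<Sum>w\<in>V. (q v w x' x - D v w) * h w)" if v: "v \<in> V" for v
    proof -
      have "g v x' - g v x = (\<Sum>w\<in>V. q v w x' x * h w)"
        unfolding q[OF v] by (rule sum.cong) (auto simp: x'_def)
      moreover have "(\<Sum>w\<in>V. D v w * h w) = e v"
        unfolding h_def by (rule mutually_inverse_apply[OF fin _ v]) (use inv in \<open>simp add: D_def\<close>)
      moreover have "(\<Sum>w\<in>V. (q v w x' x - D v w) * h w)
          = (\<Sum>w\<in>V. q v w x' x * h w) - (\<Sum>w\<in>V. D v w * h w)"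
        by (simp only: left_diff_distrib sum_subtractf)
      ultimately show ?thesis by (simp add: e_def) (simp add: algebra_simps)
    qed
    then have "c * (\<Sum>v\<in>V. norm (y v - g v x')) = c * (\<Sum>v\<in>V. norm (\<Sum>w\<in>V. (q v w x' x - D v w) * h w))"
      by simp
    also have "\<dots> \<le> 1/2 * (\<Sum>w\<in>V. norm (h w))" by (rule qD1[OF x'B xB])
    also have "\<dots> \<le> 1/2 * (c * (\<Sum>v\<in>V. norm (e v)))"
      unfolding h_def by (intro mult_left_mono Cc) auto
    finally have "(\<Sum>v\<in>V. norm (y v - g v x')) \<le> 1/2 * (\<Sum>v\<in>V. norm (e v))"
      using c by (simp add: mult.left_commute[of _ c])
    with xmin[OF x'B] have "(\<Sum>v\<in>V. norm (e v)) \<le> 0" by (simp add: e_def)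
    then have "(\<Sum>v\<in>V. norm (e v)) = 0"
      by (intro order_antisym sum_nonneg norm_ge_zero)
    then have "\<forall>v\<in>V. norm (e v) = 0" using fin by (simp add: sum_nonneg_eq_0_iff)
    then show "\<exists>x. \<forall>v\<in>V. g v x = y v" by (intro exI[of _ x]) (simp add: e_def)
  qed
qed

section \<open>Algebraic dependence\<close>

text \<open>
The monomial \<open>x\<^sup>a\<close> as a function of \<open>x\<close>.
\<close>

definition power_product :: "'v set \<Rightarrow> ('v \<Rightarrow> nat) \<Rightarrow> ('v \<Rightarrow> complex) \<Rightarrow> complex" where
  "power_product V a x = (\<Prod>v\<in>V. x v ^ a v)"

text \<open>
Exponents are extensional functions on \<open>V\<close>, so that there are finitely many and they can be counted.
\<close>

definition exponents :: "'v set \<Rightarrow> nat \<Rightarrow> ('v \<Rightarrow> nat) set" where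
  "exponents V d = PiE V (\<lambda>_. {..d})"

text \<open>
Bounding the degree in each variable separately, and not the total degree, makes the number of
monomials the power \<open>(d + 1) ^ card V\<close>.
\<close>

definition coord_degree_le :: "'v set \<Rightarrow> nat \<Rightarrow> (('v \<Rightarrow> complex) \<Rightarrow> complex) \<Rightarrow> bool" where
  "coord_degree_le V d p \<longleftrightarrow> (\<exists>c. \<forall>x. p x = (\<Sum>a\<in>exponents V d. c a * power_product V a x))"

lemma finite_exponents: "finite V \<Longrightarrow> finite (exponents V d)"
  unfolding exponents_def by (intro finite_PiE) auto

lemma card_exponents: "finite V \<Longrightarrow> card (exponents V d) = Suc d ^ card V"
  unfolding exponents_def by (simp add: card_PiE)

lemma power_product_polyfun: "power_product V a \<in> polyfun V"
proof -
  have "(\<lambda>x. \<Prod>v\<in>V. x v ^ a v) \<in> polyfun V" by (intro polyfun_prod polyfun_power polyfun.var)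
  then show ?thesis unfolding power_product_def .
qed

lemma coord_degree_le_cmult: "coord_degree_le V d p \<Longrightarrow> coord_degree_le V d (\<lambda>x. c * p x)"
proof -
  assume "coord_degree_le V d p"
  then obtain e where "\<forall>x. p x = (\<Sum>a\<in>exponents V d. e a * power_product V a x)" unfolding coord_degree_le_def by blast
  then show ?thesis unfolding coord_degree_le_def
    by (intro exI[of _ "\<lambda>a. c * e a"]) (simp add: sum_distrib_left mult.assoc)
qed

lemma coord_degree_le_add:
  assumes "coord_degree_le V d p" "coord_degree_le V d q" shows "coord_degree_le V d (\<lambda>x. p x + q x)"
proof -
  obtain e f where "\<forall>x. p x = (\<Sum>a\<in>exponents V d. e a * power_product V a x)" "\<forall>x. q x = (\<Sum>a\<in>exponents V d. f a * power_product V a x)"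
    using assms unfolding coord_degree_le_def by blast
  then show ?thesis unfolding coord_degree_le_def
    by (intro exI[of _ "\<lambda>a. e a + f a"]) (simp add: sum.distrib distrib_right)
qed

lemma coord_degree_le_sum:
  "(\<And>i. i \<in> I \<Longrightarrow> coord_degree_le V d (p i)) \<Longrightarrow> coord_degree_le V d (\<lambda>x. \<Sum>i\<in>I. p i x)"
proof (induction I rule: infinite_finite_induct)
  case (insert i I)
  then show ?case by (simp add: coord_degree_le_add)
qed (auto simp: coord_degree_le_def intro!: exI[of _ "\<lambda>_. 0"])

lemma coord_degree_le_power_product:
  assumes "finite V" "\<And>v. v \<in> V \<Longrightarrow> a v \<le> d"
  shows "coord_degree_le V d (power_product V a)"
proof -
  have r: "restrict a V \<in> exponents V d" using assms(2) by (auto simp: exponents_def)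
  have "power_product V (restrict a V) x = power_product V a x" for x unfolding power_product_def by (rule prod.cong) auto
  moreover have "(\<Sum>b\<in>exponents V d. (if b = restrict a V then 1 else 0) * power_product V b x) = power_product V (restrict a V) x" for x
    using r finite_exponents[OF assms(1)] by (simp add: if_distrib[of "\<lambda>c. c * _"] cong: if_cong)
  ultimately show ?thesis unfolding coord_degree_le_def
    by (intro exI[of _ "\<lambda>b. if b = restrict a V then 1 else 0"]) simp
qed

lemma coord_degree_le_mult:
  assumes V: "finite V" and "coord_degree_le V d p" "coord_degree_le V e q"
  shows "coord_degree_le V (d + e) (\<lambda>x. p x * q x)"
proof -
  obtain c where c: "\<forall>x. p x = (\<Sum>a\<in>exponents V d. c a * power_product V a x)"
    using assms unfolding coord_degree_le_def by blast
  obtain f where f: "\<forall>x. q x = (\<Sum>a\<in>exponents V e. f a * power_product V a x)"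
    using assms unfolding coord_degree_le_def by blast
  have "p x * q x = (\<Sum>a\<in>exponents V d. \<Sum>b\<in>exponents V e. c a * f b * power_product V (\<lambda>v. a v + b v) x)" for x
    unfolding c[rule_format] f[rule_format] sum_product
    by (intro sum.cong refl) (simp add: power_product_def power_add prod.distrib mult_ac)
  moreover have "coord_degree_le V (d + e) (\<lambda>x. \<Sum>a\<in>exponents V d. \<Sum>b\<in>exponents V e. c a * f b * power_product V (\<lambda>v. a v + b v) x)"
  proof (intro coord_degree_le_sum coord_degree_le_cmult coord_degree_le_power_product V)
    fix a b v assume "a \<in> exponents V d" "b \<in> exponents V e" "v \<in> V"
    then show "a v + b v \<le> d + e" by (intro add_mono) (auto simp: exponents_def)
  qed
  ultimately show ?thesis by simp
qed

lemma coord_degree_le_mono: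
  assumes V: "finite V" and "coord_degree_le V d p" "d \<le> e"
  shows "coord_degree_le V e p"
proof -
  obtain c where c: "\<forall>x. p x = (\<Sum>a\<in>exponents V d. c a * power_product V a x)"
    using assms unfolding coord_degree_le_def by blast
  have "coord_degree_le V e (\<lambda>x. \<Sum>a\<in>exponents V d. c a * power_product V a x)"
  proof (intro coord_degree_le_sum coord_degree_le_cmult coord_degree_le_power_product V)
    fix a v assume "a \<in> exponents V d" "v \<in> V"
    then have "a v \<le> d" by (auto simp: exponents_def)
    then show "a v \<le> e" using assms(3) by simp
  qed
  moreover have "p = (\<lambda>x. \<Sum>a\<in>exponents V d. c a * power_product V a x)" using c by blast
  ultimately show ?thesis by simp
qed

lemma coord_degree_le_const: "finite V \<Longrightarrow> coord_degree_le V d (\<lambda>_. c)"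
  using coord_degree_le_cmult[OF coord_degree_le_power_product[of V "\<lambda>_. 0" d], of c] by (simp add: power_product_def)

lemma polyfun_coord_degree_le:
  assumes V: "finite V" and "p \<in> polyfun V"
  shows "\<exists>d. coord_degree_le V d p"
  using assms(2)
proof induction
  case (const c)
  show ?case using coord_degree_le_const[OF V] by blast
next
  case (var v)
  have "power_product V (\<lambda>u. if u = v then 1 else 0) x = x v" for x
    using V var by (simp add: power_product_def if_distrib[of "\<lambda>k. _ ^ k"] cong: if_cong)
  moreover have "coord_degree_le V 1 (power_product V (\<lambda>u. if u = v then 1 else 0))" by (rule coord_degree_le_power_product[OF V]) auto
  ultimately have "coord_degree_le V 1 (\<lambda>x. x v)" unfolding coord_degree_le_def by simp
  then show ?case by blast
next
  case (add p q)
  then obtain d e where "coord_degree_le V d p" "coord_degree_le V e q" by blast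
  then have "coord_degree_le V (max d e) (\<lambda>x. p x + q x)"
    by (intro coord_degree_le_add coord_degree_le_mono[OF V _ max.cobounded1] coord_degree_le_mono[OF V _ max.cobounded2])
  then show ?case by blast
next
  case (mult p q)
  then show ?case using coord_degree_le_mult[OF V] by blast
qed

lemma coord_degree_le_power:
  assumes "finite V" "coord_degree_le V d p"
  shows "coord_degree_le V (k * d) (\<lambda>x. p x ^ k)"
proof (induction k)
  case 0
  show ?case using coord_degree_le_const[OF assms(1)] by simp
next
  case (Suc k)
  from coord_degree_le_mult[OF assms(1) assms(2) Suc] show ?case by simp
qed

lemma coord_degree_le_prod:
  assumes "finite V" "\<And>i. i \<in> I \<Longrightarrow> coord_degree_le V d (p i)"
  shows "coord_degree_le V (card I * d) (\<lambda>x. \<Prod>i\<in>I. p i x)"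
  using assms(2)
proof (induction I rule: infinite_finite_induct)
  case (insert i I)
  have "coord_degree_le V (d + card I * d) (\<lambda>x. p i x * (\<Prod>i\<in>I. p i x))"
    using insert by (intro coord_degree_le_mult assms(1)) auto
  then show ?case using insert.hyps by simp
qed (use coord_degree_le_const[OF assms(1)] in auto)

text \<open>
Induction on the number of variables: for fixed values of the other variables the sum is a
polynomial in one variable that vanishes everywhere.
\<close>

lemma power_product_independent:
  assumes "finite V" and "\<And>y. (\<Sum>a\<in>exponents V D. c a * power_product V a y) = 0"
  shows "\<forall>a\<in>exponents V D. c a = 0"
  using assms
proof (induction V arbitrary: c rule: finite_induct)
  case empty
  then show ?case by (simp add: exponents_def power_product_def)
next
  case (insert v V)
  have exponents: "exponents (insert v V) D = (\<lambda>(k, a). a(v := k)) ` ({..D} \<times> exponents V D)"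
    unfolding exponents_def by (rule PiE_insert_eq)
  have inj: "inj_on (\<lambda>(k, a). a(v := k)) ({..D} \<times> exponents V D)"
    unfolding exponents_def by (rule inj_combinator) (rule insert.hyps)
  have power_product: "power_product (insert v V) (a(v := k)) (y(v := t)) = t ^ k * power_product V a y" for a k y t
  proof -
    have "(\<Prod>u\<in>V. (y(v := t)) u ^ (a(v := k)) u) = (\<Prod>u\<in>V. y u ^ a u)"
      using insert.hyps(2) by (intro prod.cong) auto
    then show ?thesis using insert.hyps by (simp add: power_product_def)
  qed
  have "(\<Sum>a\<in>exponents V D. c (a(v := k)) * power_product V a y) = 0" if k: "k \<le> D" for y k
  proof -
    have "(\<Sum>k\<le>D. (\<Sum>a\<in>exponents V D. c (a(v := k)) * power_product V a y) * t ^ k) = 0" for t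
    proof -
      have "(\<Sum>k\<le>D. (\<Sum>a\<in>exponents V D. c (a(v := k)) * power_product V a y) * t ^ k)
          = (\<Sum>k\<le>D. \<Sum>a\<in>exponents V D. c (a(v := k)) * power_product (insert v V) (a(v := k)) (y(v := t)))"
        by (simp add: power_product sum_distrib_left sum_distrib_right mult_ac)
      also have "\<dots> = (\<Sum>(k, a)\<in>{..D} \<times> exponents V D. c (a(v := k)) * power_product (insert v V) (a(v := k)) (y(v := t)))"
        by (rule sum.cartesian_product)
      also have "\<dots> = (\<Sum>a\<in>exponents (insert v V) D. c a * power_product (insert v V) a (y(v := t)))"
        unfolding exponents by (subst sum.reindex[OF inj]) (simp add: case_prod_beta comp_def)
      also have "\<dots> = 0" by (rule insert.prems)
      finally show ?thesis .
    qed
    then show ?thesis using k polyfun_eq_0[of "\<lambda>k. \<Sum>a\<in>exponents V D. c (a(v := k)) * power_product V a y" D] by simp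
  qed
  then have "\<forall>a\<in>exponents V D. c (a(v := k)) = 0" if "k \<le> D" for k
    using insert.IH[of "\<lambda>a. c (a(v := k))"] that by blast
  then show ?case unfolding exponents by auto
qed

text \<open>
Gaussian elimination: an equation in which some unknown \<open>j\<close> occurs is used to eliminate \<open>j\<close>.
\<close>

lemma homogeneous_system_solvable:
  fixes c :: "'i \<Rightarrow> 'm \<Rightarrow> complex"
  assumes "finite M" "finite I" "card M < card I"
  shows "\<exists>l. (\<exists>i\<in>I. l i \<noteq> 0) \<and> (\<forall>m\<in>M. (\<Sum>i\<in>I. l i * c i m) = 0)"
  using assms
proof (induction M arbitrary: I c rule: finite_induct)
  case empty
  then have "I \<noteq> {}" by auto
  then show ?case by (intro exI[of _ "\<lambda>_. 1"]) auto
next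
  case (insert m M)
  show ?case
  proof (cases "\<forall>i\<in>I. c i m = 0")
    case True
    have "card M < card I" using insert by simp
    from insert.IH[OF insert.prems(1) this, of c] True show ?thesis by auto
  next
    case False
    then obtain j where j: "j \<in> I" "c j m \<noteq> 0" by blast
    have cI: "card M < card (I - {j})" using insert j by simp
    obtain l where l: "\<exists>i\<in>I - {j}. l i \<noteq> 0"
      "\<And>k. k \<in> M \<Longrightarrow> (\<Sum>i\<in>I - {j}. l i * (c i k - c i m / c j m * c j k)) = 0"
      using insert.IH[OF _ cI, of "\<lambda>i k. c i k - c i m / c j m * c j k"] insert.prems(1) by auto
    define s where "s = (\<Sum>i\<in>I - {j}. l i * c i m) / c j m"
    define l' where "l' = l(j := - s)"
    have sum: "(\<Sum>i\<in>I. l' i * c i k) = (\<Sum>i\<in>I - {j}. l i * c i k) - s * c j k" for k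
      using insert.prems(1) j(1) by (simp add: sum.remove[of I j] l'_def)
    have "(\<Sum>i\<in>I. l' i * c i k) = 0" if "k \<in> M" for k
    proof -
      have "(\<Sum>i\<in>I - {j}. l i * (c i k - c i m / c j m * c j k)) = (\<Sum>i\<in>I - {j}. l i * c i k) - s * c j k"
        unfolding s_def by (simp add: right_diff_distrib sum_subtractf sum_divide_distrib sum_distrib_right mult.assoc)
      with l(2)[OF that] sum show ?thesis by simp
    qed
    moreover have "(\<Sum>i\<in>I. l' i * c i m) = 0" unfolding sum s_def using j(2) by simp
    moreover have "\<exists>i\<in>I. l' i \<noteq> 0" using l(1) by (auto simp: l'_def)
    ultimately show ?thesis by (intro exI[of _ l']) auto
  qed
qed

text \<open>
There are \<open>N + 1\<close> polynomials \<open>g v\<close> and \<open>h\<close> in \<open>N\<close> variables. The products of their powers with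
exponents up to \<open>D\<close> number \<open>(D + 1)\<^bsup>N+1\<^esup>\<close>, whereas the monomials that occur in them number
\<open>O(D\<^sup>N)\<close>. For large \<open>D\<close> some linear combination of these products is zero.
\<close>

lemma algebraically_dependent:
  fixes g :: "'v \<Rightarrow> ('v \<Rightarrow> complex) \<Rightarrow> complex"
  assumes V: "finite V" and g: "\<And>v. v \<in> V \<Longrightarrow> g v \<in> polyfun V" and h: "h \<in> polyfun V"
  shows "\<exists>A D. (\<forall>k. A k \<in> polyfun V) \<and> (\<exists>k\<le>D. \<exists>y. A k y \<noteq> 0) \<and>
           (\<forall>x. (\<Sum>k\<le>D. A k (\<lambda>v. g v x) * h x ^ k) = 0)"
proof -
  have "\<exists>d. \<forall>v\<in>V. coord_degree_le V d (g v)"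
  proof -
    have "\<forall>v\<in>V. \<exists>d. coord_degree_le V d (g v)" using polyfun_coord_degree_le[OF V g] by blast
    then obtain d where d: "\<forall>v\<in>V. coord_degree_le V (d v) (g v)" by (rule bchoice[THEN exE])
    have "coord_degree_le V (sum d V) (g v)" if v: "v \<in> V" for v
      by (rule coord_degree_le_mono[OF V bspec[OF d v]]) (rule member_le_sum[of v V d, OF v _ V], simp)
    then show ?thesis by blast
  qed
  then obtain d1 where d1: "\<forall>v\<in>V. coord_degree_le V d1 (g v)" by blast
  obtain d2 where d2: "coord_degree_le V d2 h" using polyfun_coord_degree_le[OF V h] by blast
  define d where "d = max d1 d2"
  have gd: "coord_degree_le V d (g v)" if "v \<in> V" for v
    using coord_degree_le_mono[OF V bspec[OF d1 that]] by (simp add: d_def)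
  have hd: "coord_degree_le V d h" using coord_degree_le_mono[OF V d2] by (simp add: d_def)
  define N where "N = card V"
  \<comment> \<open>The products have degree at most \<open>E\<close> in each variable, and
    \<open>(E + 1)\<^sup>N \<le> (Suc N * d + 1)\<^sup>N (D + 1)\<^sup>N = D (D + 1)\<^sup>N < (D + 1)\<^bsup>N+1\<^esup>\<close>.\<close>
  define D where "D = (Suc N * d + 1) ^ N"
  define E where "E = Suc N * (D * d)"
  define I where "I = exponents V D \<times> {..D}"
  define p where "p i x = (\<Prod>v\<in>V. g v x ^ fst i v) * h x ^ snd i" for i x
  have p: "coord_degree_le V E (p i)" if "i \<in> I" for i
  proof -
    have i: "fst i v \<le> D" if "v \<in> V" for v using \<open>i \<in> I\<close> that by (auto simp: I_def exponents_def)
    have "coord_degree_le V (D * d) (\<lambda>x. g v x ^ fst i v)" if "v \<in> V" for v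
      by (rule coord_degree_le_mono[OF V coord_degree_le_power[OF V gd[OF that]]]) (use i[OF that] in simp)
    then have "coord_degree_le V (N * (D * d)) (\<lambda>x. \<Prod>v\<in>V. g v x ^ fst i v)"
      unfolding N_def by (rule coord_degree_le_prod[OF V])
    moreover have "coord_degree_le V (D * d) (\<lambda>x. h x ^ snd i)"
      by (rule coord_degree_le_mono[OF V coord_degree_le_power[OF V hd]]) (use \<open>i \<in> I\<close> in \<open>auto simp: I_def\<close>)
    ultimately have "coord_degree_le V (N * (D * d) + D * d) (p i)"
      unfolding p_def by (rule coord_degree_le_mult[OF V])
    then show ?thesis by (simp add: E_def add.commute)
  qed
  then have "\<forall>i\<in>I. \<exists>c. \<forall>x. p i x = (\<Sum>m\<in>exponents V E. c m * power_product V m x)" unfolding coord_degree_le_def by blast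
  then obtain c where c: "\<forall>i\<in>I. \<forall>x. p i x = (\<Sum>m\<in>exponents V E. c i m * power_product V m x)"
    by (rule bchoice[THEN exE])
  have "card (exponents V E) < card I"
  proof -
    have "Suc E \<le> (Suc N * d + 1) * Suc D" by (simp add: E_def algebra_simps)
    then have "Suc E ^ N \<le> ((Suc N * d + 1) * Suc D) ^ N" by (rule power_mono) simp
    also have "\<dots> = D * Suc D ^ N" unfolding power_mult_distrib D_def ..
    also have "\<dots> < Suc D * Suc D ^ N" by simp
    finally show ?thesis using V by (simp add: card_exponents I_def N_def card_cartesian_product mult.commute)
  qed
  moreover have "finite I" unfolding I_def using finite_exponents[OF V] by simp
  ultimately obtain l where l: "\<exists>i\<in>I. l i \<noteq> 0" "\<forall>m\<in>exponents V E. (\<Sum>i\<in>I. l i * c i m) = 0"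
    using homogeneous_system_solvable[where c = c and I = I and M = "exponents V E"] finite_exponents[OF V] by blast
  have rel: "(\<Sum>i\<in>I. l i * p i x) = 0" for x
  proof -
    have "(\<Sum>i\<in>I. l i * p i x) = (\<Sum>i\<in>I. \<Sum>m\<in>exponents V E. l i * c i m * power_product V m x)"
      by (rule sum.cong) (use c in \<open>auto simp: sum_distrib_left mult.assoc\<close>)
    also have "\<dots> = (\<Sum>m\<in>exponents V E. (\<Sum>i\<in>I. l i * c i m) * power_product V m x)"
      by (subst sum.swap) (simp add: sum_distrib_right)
    also have "\<dots> = 0" using l(2) by simp
    finally show ?thesis .
  qed
  define A where "A k y = (\<Sum>a\<in>exponents V D. l (a, k) * power_product V a y)" for k y
  have "A k \<in> polyfun V" for k
  proof -
    have "(\<lambda>y. \<Sum>a\<in>exponents V D. l (a, k) * power_product V a y) \<in> polyfun V"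
      by (intro polyfun_sum polyfun.mult polyfun.const power_product_polyfun)
    then show ?thesis unfolding A_def .
  qed
  moreover have "\<exists>k\<le>D. \<exists>y. A k y \<noteq> 0"
  proof (rule ccontr)
    assume "\<not> ?thesis"
    then have "\<forall>a\<in>exponents V D. l (a, k) = 0" if "k \<le> D" for k
      using power_product_independent[OF V, where D = D and c = "\<lambda>a. l (a, k)"] that unfolding A_def by blast
    then show False using l(1) unfolding I_def by auto
  qed
  moreover have "(\<Sum>k\<le>D. A k (\<lambda>v. g v x) * h x ^ k) = 0" for x
  proof -
    have "(\<Sum>k\<le>D. A k (\<lambda>v. g v x) * h x ^ k) = (\<Sum>k\<le>D. \<Sum>a\<in>exponents V D. l (a, k) * p (a, k) x)"
      unfolding A_def p_def power_product_def by (simp add: sum_distrib_left sum_distrib_right mult_ac)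
    also have "\<dots> = (\<Sum>a\<in>exponents V D. \<Sum>k\<le>D. l (a, k) * p (a, k) x)" by (rule sum.swap)
    also have "\<dots> = (\<Sum>i\<in>I. l i * p i x)" unfolding I_def by (subst sum.cartesian_product) (simp add: case_prod_beta)
    finally show ?thesis using rel by simp
  qed
  ultimately show ?thesis by blast
qed

lemma algebraic_equation_top_coeff:
  fixes g :: "'v \<Rightarrow> ('v \<Rightarrow> complex) \<Rightarrow> complex"
  assumes V: "finite V" and g: "\<And>v. v \<in> V \<Longrightarrow> g v \<in> polyfun V" and h: "h \<in> polyfun V"
  shows "\<exists>A K. (\<forall>k. A k \<in> polyfun V) \<and> (\<exists>y. A K y \<noteq> 0) \<and>
           (\<forall>x. (\<Sum>k\<le>K. A k (\<lambda>v. g v x) * h x ^ k) = 0)"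
proof -
  obtain A D where A: "\<forall>k. A k \<in> polyfun V" "\<exists>k\<le>D. \<exists>y. A k y \<noteq> 0"
    "\<forall>x. (\<Sum>k\<le>D. A k (\<lambda>v. g v x) * h x ^ k) = 0"
    using algebraically_dependent[where g = g, OF assms] by blast
  define P where "P k \<longleftrightarrow> k \<le> D \<and> (\<exists>y. A k y \<noteq> 0)" for k
  define K where "K = Greatest P"
  have "\<exists>k. P k" using A(2) unfolding P_def by blast
  then have K: "P K" unfolding K_def by (rule GreatestI_ex_nat[of P D]) (simp add: P_def)
  have top: "k \<le> K" if "P k" for k
    unfolding K_def by (rule Greatest_le_nat[of P k D]) (use that in \<open>auto simp: P_def\<close>)
  have "(\<Sum>k\<le>K. A k (\<lambda>v. g v x) * h x ^ k) = (\<Sum>k\<le>D. A k (\<lambda>v. g v x) * h x ^ k)" for x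
  proof (rule sum.mono_neutral_left)
    show "{..K} \<subseteq> {..D}" using K by (auto simp: P_def)
    show "\<forall>k\<in>{..D} - {..K}. A k (\<lambda>v. g v x) * h x ^ k = 0" 
    proof
      fix k assume k: "k \<in> {..D} - {..K}"
      then have "\<not> P k" using top by auto
      then show "A k (\<lambda>v. g v x) * h x ^ k = 0" using k unfolding P_def by simp
    qed
  qed simp
  then show ?thesis using A K unfolding P_def by (intro exI[of _ A] exI[of _ K]) auto
qed

text \<open>
If the lowest nonzero coefficient is that of \<open>h\<^sup>L\<close>, the equation is divisible by \<open>h\<^sup>L\<close>, which can be
cancelled because polynomial functions form an integral domain and \<open>h\<close> is not zero.
\<close>

lemma algebraic_equation_constant_coeff:
  fixes g :: "'v \<Rightarrow> ('v \<Rightarrow> complex) \<Rightarrow> complex"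
  assumes V: "finite V" and g: "\<And>v. v \<in> V \<Longrightarrow> g v \<in> polyfun V" and h: "h \<in> polyfun V"
    and h0: "h x0 \<noteq> 0"
  shows "\<exists>A K. (\<forall>k. A k \<in> polyfun V) \<and> (\<exists>y. A 0 y \<noteq> 0) \<and>
           (\<forall>x. (\<Sum>k\<le>K. A k (\<lambda>v. g v x) * h x ^ k) = 0)"
proof -
  obtain A D where A: "\<forall>k. A k \<in> polyfun V" "\<exists>k\<le>D. \<exists>y. A k y \<noteq> 0"
    "\<forall>x. (\<Sum>k\<le>D. A k (\<lambda>v. g v x) * h x ^ k) = 0"
    using algebraically_dependent[where g = g, OF V g h] by blast
  define L where "L = (LEAST k. \<exists>y. A k y \<noteq> 0)"
  have L: "\<exists>y. A L y \<noteq> 0" unfolding L_def by (rule LeastI_ex) (use A(2) in blast)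
  have low: "A k y = 0" if "k < L" for k y
    using not_less_Least[of k "\<lambda>k. \<exists>y. A k y \<noteq> 0"] that unfolding L_def by blast
  have LD: "L \<le> D"
  proof (rule ccontr)
    assume "\<not> L \<le> D"
    then have "A k y = 0" if "k \<le> D" for k y using that low by simp
    then show False using A(2) by blast
  qed
  define B where "B k = A (k + L)" for k
  define R where "R x = (\<Sum>k\<le>D - L. B k (\<lambda>v. g v x) * h x ^ k)" for x
  have "h x ^ L * R x = (\<Sum>k\<le>D. A k (\<lambda>v. g v x) * h x ^ k)" for x
  proof -
    have "h x ^ L * R x = (\<Sum>k\<le>D - L. A (k + L) (\<lambda>v. g v x) * h x ^ (k + L))"
      unfolding R_def B_def by (simp add: sum_distrib_left power_add mult_ac)
    also have "\<dots> = (\<Sum>k\<in>{L..D}. A k (\<lambda>v. g v x) * h x ^ k)"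
      by (rule sum.reindex_bij_witness[of _ "\<lambda>k. k - L" "\<lambda>k. k + L"]) (use LD in auto)
    also have "\<dots> = (\<Sum>k\<le>D. A k (\<lambda>v. g v x) * h x ^ k)"
      by (rule sum.mono_neutral_left) (use low in auto)
    finally show ?thesis .
  qed
  then have prod: "h x ^ L * R x = 0" for x using A(3) by simp
  have Rp: "R \<in> polyfun V"
  proof -
    have "(\<lambda>x. B k (\<lambda>v. g v x)) \<in> polyfun V" for k
      by (rule polyfun_subst[where p = "B k" and g = g and V = V]) (use A(1) g in \<open>simp_all add: B_def\<close>)
    then have "(\<lambda>x. \<Sum>k\<le>D - L. B k (\<lambda>v. g v x) * h x ^ k) \<in> polyfun V"
      using h by (intro polyfun_sum polyfun.mult polyfun_power)
    then show ?thesis unfolding R_def .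
  qed
  have hL: "(\<lambda>x. h x ^ L) \<in> polyfun V" using h by (rule polyfun_power)
  have "R x = 0" for x
  proof (rule ccontr)
    assume "R x \<noteq> 0"
    then have "\<exists>z. h z ^ L * R z \<noteq> 0"
      using h0 polyfun_mult_nonzero[OF hL Rp, of x0 x] by simp
    then show False using prod by simp
  qed
  then show ?thesis using A(1) L unfolding R_def
    by (intro exI[of _ B] exI[of _ "D - L"]) (auto simp: B_def)
qed

section \<open>Generic surjectivity of nondegenerate polynomial maps\<close>

text \<open>
\<open>J\<close> is the determinant, computed after numbering the index set \<open>V\<close>.
\<close>

lemma polyfun_matrix_nonsingular:
  fixes m :: "'v \<Rightarrow> 'v \<Rightarrow> ('u \<Rightarrow> complex) \<Rightarrow> complex"
  assumes V: "finite V"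
    and m: "\<And>v w. v \<in> V \<Longrightarrow> w \<in> V \<Longrightarrow> m v w \<in> polyfun X"
    and inv: "mutually_inverse V (\<lambda>v w. m v w x0) C"
  shows "\<exists>J\<in>polyfun X. J x0 \<noteq> 0 \<and> (\<forall>x. J x \<noteq> 0 \<longrightarrow> (\<exists>B. mutually_inverse V (\<lambda>v w. m v w x) B))"
proof -
  define N where "N = card V"
  obtain b where b: "bij_betw b {0..<N} V" using ex_bij_betw_nat_finite[OF V] unfolding N_def by blast
  define i where "i = inv_into {0..<N} b"
  have bV: "b k \<in> V" if "k < N" for k using b that unfolding bij_betw_def by auto
  have ib: "i (b k) = k" if "k < N" for k
    unfolding i_def by (rule inv_into_f_f) (use b that in \<open>auto simp: bij_betw_def\<close>)
  have bi: "b (i v) = v" "i v < N" if "v \<in> V" for v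
  proof -
    have v: "v \<in> b ` {0..<N}" using b that unfolding bij_betw_def by simp
    show "b (i v) = v" unfolding i_def by (rule f_inv_into_f[OF v])
    show "i v < N" using inv_into_into[OF v] unfolding i_def by simp
  qed
  define T :: "('v \<Rightarrow> 'v \<Rightarrow> complex) \<Rightarrow> complex mat" where "T A = Matrix.mat N N (\<lambda>(k, l). A (b k) (b l))" for A
  have T: "T A \<in> carrier_mat N N" for A unfolding T_def by simp
  have dim: "dim_row (T A) = N" "dim_col (T A) = N" for A unfolding T_def by simp_all
  have prod: "(T A * T B) $$ (k, l) = (\<Sum>u\<in>V. A (b k) u * B u (b l))" if "k < N" "l < N" for A B k l
  proof -
    have "(T A * T B) $$ (k, l) = (\<Sum>j = 0..<N. A (b k) (b j) * B (b j) (b l))"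
      using that unfolding T_def by (simp add: scalar_prod_def)
    also have "\<dots> = (\<Sum>u\<in>V. A (b k) u * B u (b l))"
      by (rule sum.reindex_bij_betw[OF b, of "\<lambda>u. A (b k) u * B u (b l)"])
    finally show ?thesis .
  qed
  have inj: "b k = b l \<longleftrightarrow> k = l" if "k < N" "l < N" for k l
  proof
    assume "b k = b l"
    then have "i (b k) = i (b l)" by (rule arg_cong)
    then show "k = l" unfolding ib[OF that(1)] ib[OF that(2)] .
  qed (rule arg_cong)
  have to: "T A * T B = 1\<^sub>m N" if "mutually_inverse V A B" for A B
  proof (rule eq_matI)
    fix k l assume "k < dim_row (1\<^sub>m N)" "l < dim_col (1\<^sub>m N)"
    then have kl: "k < N" "l < N" by auto
    have "(\<Sum>u\<in>V. A (b k) u * B u (b l)) = (if b k = b l then 1 else 0)"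
      using that[unfolded mutually_inverse_def, rule_format, OF bV[OF kl(1)] bV[OF kl(2)]] by (rule conjunct1)
    then show "(T A * T B) $$ (k, l) = 1\<^sub>m N $$ (k, l)"
      unfolding prod[OF kl] inj[OF kl] using kl by simp
  qed (simp_all add: dim)
  define J where "J x = det (T (\<lambda>v w. m v w x))" for x
  have "(\<lambda>x. \<Sum>p\<in>{p. p permutes {0..<N}}. signof p * (\<Prod>k = 0..<N. m (b k) (b (p k)) x)) \<in> polyfun X"
  proof (rule polyfun_sum, rule polyfun.mult[OF polyfun.const], rule polyfun_prod, rule m)
    fix p k assume p: "p \<in> {p. p permutes {0..<N}}" and k: "k \<in> {0..<N}"
    from k show "b k \<in> V" using bV by simp
    have "p k \<in> {0..<N}" using permutes_in_image[of p "{0..<N}" k] p k by blast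
    then show "b (p k) \<in> V" using bV by simp
  qed
  also have "(\<lambda>x. \<Sum>p\<in>{p. p permutes {0..<N}}. signof p * (\<Prod>k = 0..<N. m (b k) (b (p k)) x)) = J"
  proof (rule ext)
    fix x
    have "T (\<lambda>v w. m v w x) $$ (k, p k) = m (b k) (b (p k)) x" if "p permutes {0..<N}" "k \<in> {0..<N}" for p k
    proof -
      have "p k \<in> {0..<N}" using permutes_in_image[of p "{0..<N}" k] that by blast
      then show ?thesis using that(2) unfolding T_def by simp
    qed
    then show "(\<Sum>p\<in>{p. p permutes {0..<N}}. signof p * (\<Prod>k = 0..<N. m (b k) (b (p k)) x)) = J x"
      unfolding J_def det_def'[OF T] by (intro sum.cong refl arg_cong2[of _ _ _ _ "(*)"] prod.cong) simp_all
  qed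
  finally have "J \<in> polyfun X" .
  moreover have "J x0 \<noteq> 0"
  proof
    assume "J x0 = 0"
    moreover have "det (T (\<lambda>v w. m v w x0)) * det (T C) = 1"
      unfolding det_mult[OF T T, symmetric] to[OF inv] by simp
    ultimately show False unfolding J_def by simp
  qed
  moreover have "\<exists>B. mutually_inverse V (\<lambda>v w. m v w x) B" if "J x \<noteq> 0" for x
  proof -
    let ?M = "T (\<lambda>v w. m v w x)"
    have "?M \<in> Units (ring_mat TYPE(complex) N ())"
      by (rule det_non_zero_imp_unit[OF T]) (use that in \<open>simp add: J_def\<close>)
    then obtain B where B: "B \<in> carrier_mat N N" "B * ?M = 1\<^sub>m N" "?M * B = 1\<^sub>m N"
      unfolding Units_def ring_mat_simps by blast
    define B' where "B' v w = B $$ (i v, i w)" for v w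
    have TB: "T B' = B"
    proof (rule eq_matI)
      fix k l assume kl: "k < dim_row B" "l < dim_col B"
      then show "T B' $$ (k, l) = B $$ (k, l)" using B(1) unfolding T_def B'_def by (simp add: ib)
    qed (use B(1) in \<open>simp_all add: dim\<close>)
    have "(\<Sum>u\<in>V. m v u x * B' u w) = (if v = w then 1 else 0)" "(\<Sum>u\<in>V. B' v u * m u w x) = (if v = w then 1 else 0)"
      if "v \<in> V" "w \<in> V" for v w
    proof -
      have eq: "i v = i w \<longleftrightarrow> v = w"
      proof
        assume "i v = i w"
        then have "b (i v) = b (i w)" by (rule arg_cong)
        then show "v = w" unfolding bi(1)[OF that(1)] bi(1)[OF that(2)] .
      qed (rule arg_cong)
      have one: "1\<^sub>m N $$ (i v, i w) = (if v = w then 1 else (0 :: complex))"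
        using bi(2)[OF that(1)] bi(2)[OF that(2)] eq by simp
      show "(\<Sum>u\<in>V. m v u x * B' u w) = (if v = w then 1 else 0)"
        using prod[OF bi(2)[OF that(1)] bi(2)[OF that(2)], of "\<lambda>v w. m v w x" B']
        unfolding TB B(3) one bi(1)[OF that(1)] bi(1)[OF that(2)] by (rule sym)
      show "(\<Sum>u\<in>V. B' v u * m u w x) = (if v = w then 1 else 0)"
        using prod[OF bi(2)[OF that(1)] bi(2)[OF that(2)], of B' "\<lambda>v w. m v w x"]
        unfolding TB B(2) one bi(1)[OF that(1)] bi(1)[OF that(2)] by (rule sym)
    qed
    then have "mutually_inverse V (\<lambda>v w. m v w x) B'"
      unfolding mutually_inverse_def by (intro ballI conjI) assumption+
    then show ?thesis by (rule exI[where x = B'])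
  qed
  ultimately show ?thesis by blast
qed

lemma polynomial_root_bound:
  fixes c :: "nat \<Rightarrow> complex"
  assumes root: "(\<Sum>k\<le>K. c k * t ^ k) = 0" and mu: "\<mu> > 0" "\<mu> \<le> norm (c K)"
    and M: "\<And>k. k < K \<Longrightarrow> norm (c k) \<le> M"
  shows "norm t \<le> 1 + K * M / \<mu>"
proof (cases K)
  case 0
  then show ?thesis using root mu by simp
next
  case (Suc L)
  have M0: "M \<ge> 0" using M[of 0] Suc norm_ge_zero order_trans by blast
  show ?thesis
  proof (cases "norm t \<le> 1")
    case True
    then show ?thesis using M0 mu by (simp add: add_increasing2)
  next
    case False
    have split: "(\<Sum>k\<le>K. c k * t ^ k) = (\<Sum>k<K. c k * t ^ k) + c K * t ^ K"
      unfolding Suc by (simp add: lessThan_Suc_atMost)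
    have "\<mu> * norm t ^ K \<le> norm (c K * t ^ K)"
      using mu by (simp add: norm_mult norm_power mult_right_mono)
    also have "c K * t ^ K = - (\<Sum>k<K. c k * t ^ k)" using root split by (simp add: add_eq_0_iff)
    also have "norm (- (\<Sum>k<K. c k * t ^ k)) \<le> (\<Sum>k<K. M * norm t ^ L)"
      unfolding norm_minus_cancel
    proof (rule sum_norm_le)
      fix k assume "k \<in> {..<K}"
      then have k: "k < K" "k \<le> L" using Suc by auto
      show "norm (c k * t ^ k) \<le> M * norm t ^ L"
        unfolding norm_mult norm_power using M0 False k
        by (intro mult_mono M power_increasing) auto
    qed
    also have "\<dots> = K * M * norm t ^ L" by simp
    finally have "\<mu> * norm t * norm t ^ L \<le> K * M * norm t ^ L" unfolding Suc by (simp add: mult_ac)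
    moreover have "norm t ^ L > 0" using False by (intro zero_less_power) linarith
    ultimately have "\<mu> * norm t \<le> K * M" by (simp only: mult_le_cancel_right_pos)
    then have "norm t \<le> K * M / \<mu>" using mu by (simp add: pos_le_divide_eq mult.commute)
    then show ?thesis by simp
  qed
qed

lemma polyfun_line_continuous:
  assumes "p \<in> polyfun V"
  shows "continuous_on S (\<lambda>s. p (\<lambda>v. a v + s * d v))"
proof -
  obtain P where P: "\<forall>s. p (\<lambda>v. a v + s * d v) = poly P s" using polyfun_on_line[OF assms] by blast
  show ?thesis unfolding P[rule_format] by (intro continuous_intros)
qed

lemma directional_derivative_unique:
  fixes f :: "('v \<Rightarrow> complex) \<Rightarrow> complex"
  assumes V: "finite V" and w: "w \<in> V"
    and qc: "coordwise_cont V (q w)"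
    and q: "\<And>x y. f x - f y = (\<Sum>u\<in>V. q u x y * (x u - y u))"
    and D: "((\<lambda>s. f (x0(w := x0 w + s))) has_field_derivative D) (at 0)"
  shows "q w x0 x0 = D"
proof -
  have quot: "(f (x0(w := x0 w + s)) - f x0) / s = q w (x0(w := x0 w + s)) x0" if "s \<noteq> 0" for s
  proof -
    have "f (x0(w := x0 w + s)) - f x0 = (\<Sum>u\<in>V. if u = w then q w (x0(w := x0 w + s)) x0 * s else 0)"
      unfolding q by (rule sum.cong) auto
    also have "\<dots> = q w (x0(w := x0 w + s)) x0 * s" using V w by simp
    finally show ?thesis using that by simp
  qed
  have "((\<lambda>s. (f (x0(w := x0 w + s)) - f x0) / s) \<longlongrightarrow> q w x0 x0) (at 0)"
  proof (rule LIM_I)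
    fix r :: real assume "0 < r"
    from coordwise_cont_uniform[OF qc this, of x0] obtain \<delta> where \<delta>: "\<delta> > 0"
      "\<forall>x y. (\<forall>v\<in>V. norm (x v - x0 v) \<le> \<delta> \<and> norm (y v - x0 v) \<le> \<delta>) \<longrightarrow> norm (q w x y - q w x0 x0) < r"
      by blast
    have "norm ((f (x0(w := x0 w + s)) - f x0) / s - q w x0 x0) < r" if s: "s \<noteq> 0" "norm s < \<delta>" for s
      unfolding quot[OF s(1)] by (rule \<delta>(2)[rule_format]) (use \<delta>(1) s in auto)
    then show "\<exists>\<delta>>0. \<forall>s. s \<noteq> 0 \<and> norm (s - 0) < \<delta> \<longrightarrow> norm ((f (x0(w := x0 w + s)) - f x0) / s - q w x0 x0) < r"
      using \<delta>(1) by auto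
  qed
  moreover have "((\<lambda>s. (f (x0(w := x0 w + s)) - f x0) / s) \<longlongrightarrow> D) (at 0)"
    using D unfolding DERIV_def by simp
  ultimately show ?thesis by (rule LIM_unique)
qed

text \<open>
With \<open>Q\<close> built from leading and constant coefficients as described at the beginning,
join \<open>y\<close> to a point of the image by a complex line. The parameters \<open>s\<close> on the line with \<open>Q \<noteq> 0\<close> form
a connected set \<open>W\<close>, and those among them that give points of the image form a subset \<open>S\<close> that is
open and closed in \<open>W\<close>.
\<close>

theorem nonsingular_polymap_generically_surj:
  fixes g :: "'v \<Rightarrow> ('v \<Rightarrow> complex) \<Rightarrow> complex"
  assumes V: "finite V"
    and g: "\<And>v. v \<in> V \<Longrightarrow> g v \<in> polyfun V"
    and D: "\<And>v w. v \<in> V \<Longrightarrow> w \<in> V \<Longrightarrow>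
       ((\<lambda>s. g v (base(w := base w + s))) has_field_derivative D v w) (at 0)"
    and inv: "mutually_inverse V D C"
  shows "\<exists>Q\<in>polyfun V. (\<exists>y. Q y \<noteq> 0) \<and> (\<forall>y. Q y \<noteq> 0 \<longrightarrow> (\<exists>x. \<forall>v\<in>V. g v x = y v))"
proof -
  have "\<forall>v\<in>V. \<exists>q. (\<forall>w\<in>V. coordwise_cont V (q w) \<and> (\<lambda>x. q w x x) \<in> polyfun V) \<and>
             (\<forall>x y. g v x - g v y = (\<Sum>w\<in>V. q w x y * (x w - y w)))"
    using polyfun_difference_quotient[OF V g] by blast
  then obtain q where q: "\<forall>v\<in>V. (\<forall>w\<in>V. coordwise_cont V (q v w) \<and> (\<lambda>x. q v w x x) \<in> polyfun V) \<and>
             (\<forall>x y. g v x - g v y = (\<Sum>w\<in>V. q v w x y * (x w - y w)))"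
    by (rule bchoice[THEN exE])
  have qc: "coordwise_cont V (q v w)" if "v \<in> V" "w \<in> V" for v w using q that by blast
  have qp: "(\<lambda>x. q v w x x) \<in> polyfun V" if "v \<in> V" "w \<in> V" for v w using q that by blast
  have qq: "g v x - g v y = (\<Sum>w\<in>V. q v w x y * (x w - y w))" if "v \<in> V" for v x y using q that by blast
  have qD: "q v w base base = D v w" if "v \<in> V" "w \<in> V" for v w
    by (rule directional_derivative_unique[OF V that(2), of "q v" "g v" base])
      (use that in \<open>simp_all add: qc qq[symmetric] D\<close>)
  have surj: "\<exists>\<epsilon>>0. \<forall>y. (\<Sum>v\<in>V. norm (y v - g v x)) < \<epsilon> \<longrightarrow> (\<exists>z. \<forall>v\<in>V. g v z = y v)"
    if "mutually_inverse V (\<lambda>v w. q v w x x) B" for x B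
    by (rule polymap_locally_surj[where q = q and C = B, OF V g qc qq that])
  have inv0: "mutually_inverse V (\<lambda>v w. q v w base base) C"
    using inv qD unfolding mutually_inverse_def by simp
  obtain J where J: "J \<in> polyfun V" "J base \<noteq> 0"
    "\<forall>x. J x \<noteq> 0 \<longrightarrow> (\<exists>B. mutually_inverse V (\<lambda>v w. q v w x x) B)"
    using polyfun_matrix_nonsingular[where m = "\<lambda>v w x. q v w x x", OF V qp inv0] by blast
  obtain A0 K0 where A0: "\<forall>k. A0 k \<in> polyfun V" "\<exists>y. A0 0 y \<noteq> 0"
    "\<forall>x. (\<Sum>k\<le>K0. A0 k (\<lambda>v. g v x) * J x ^ k) = 0"
    using algebraic_equation_constant_coeff[where g = g, OF V g J(1,2)] by blast
  define rel where "rel w AK \<longleftrightarrow> (\<forall>k. fst AK k \<in> polyfun V) \<and> (\<exists>y. fst AK (snd AK) y \<noteq> 0) \<and>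
      (\<forall>x. (\<Sum>k\<le>snd AK. fst AK k (\<lambda>v. g v x) * x w ^ k) = 0)" for w AK
  have "\<forall>w\<in>V. \<exists>AK. rel w AK"
  proof
    fix w assume w: "w \<in> V"
    obtain A K where "(\<forall>k. A k \<in> polyfun V) \<and> (\<exists>y. A K y \<noteq> 0) \<and>
           (\<forall>x. (\<Sum>k\<le>K. A k (\<lambda>v. g v x) * x w ^ k) = 0)"
      using algebraic_equation_top_coeff[where g = g, OF V g polyfun.var[OF w]] by blast
    then have "rel w (A, K)" unfolding rel_def by simp
    then show "\<exists>AK. rel w AK" by blast
  qed
  then obtain AK where AK: "\<forall>w\<in>V. rel w (AK w)" by (rule bchoice[THEN exE])
  define A K where "A w = fst (AK w)" and "K w = snd (AK w)" for w
  have A: "A w k \<in> polyfun V" "\<exists>y. A w (K w) y \<noteq> 0"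
    "(\<Sum>k\<le>K w. A w k (\<lambda>v. g v x) * x w ^ k) = 0" if "w \<in> V" for w k x
    using bspec[OF AK that] unfolding rel_def A_def K_def by blast+
  define Q where "Q y = A0 0 y * (\<Prod>w\<in>V. A w (K w) y)" for y
  have prodp: "(\<lambda>y. \<Prod>w\<in>V. A w (K w) y) \<in> polyfun V" by (intro polyfun_prod A)
  have Qp: "Q \<in> polyfun V"
  proof -
    have "(\<lambda>y. A0 0 y * (\<Prod>w\<in>V. A w (K w) y)) \<in> polyfun V"
      using A0(1) prodp by (intro polyfun.mult) auto
    then show ?thesis unfolding Q_def .
  qed
  have Q0: "\<exists>y. Q y \<noteq> 0"
  proof -
    obtain y z where y: "A0 0 y \<noteq> 0" "(\<Prod>w\<in>V. A w (K w) z) \<noteq> 0"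
      using A0(2) polyfun_prod_nonzero[OF V, of "\<lambda>w. A w (K w)" V] A(1,2) by blast
    show ?thesis unfolding Q_def
      by (rule polyfun_mult_nonzero[where p = "A0 0" and q = "\<lambda>y. \<Prod>w\<in>V. A w (K w) y", OF _ prodp y]) (use A0 in blast)
  qed
  have QA: "A w (K w) y \<noteq> 0" if "Q y \<noteq> 0" "w \<in> V" for y w
    using that V unfolding Q_def by simp
  have QJ: "J x \<noteq> 0" if "Q (\<lambda>v. g v x) \<noteq> 0" for x
  proof
    assume J0: "J x = 0"
    have "(\<Sum>k\<le>K0. A0 k (\<lambda>v. g v x) * J x ^ k) = (\<Sum>k\<in>{0}. A0 k (\<lambda>v. g v x) * J x ^ k)"
      by (rule sum.mono_neutral_right) (auto simp: J0)
    then have "A0 0 (\<lambda>v. g v x) = 0" using A0(3) by simp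
    then show False using that unfolding Q_def by simp
  qed
  \<comment> \<open>The image contains a ball around \<open>g base\<close>, and \<open>Q\<close> cannot vanish on all of it.\<close>
  have "\<exists>z. Q (\<lambda>v. g v z) \<noteq> 0"
  proof -
    obtain y1 where y1: "Q y1 \<noteq> 0" using Q0 by blast
    obtain \<epsilon> where \<epsilon>: "\<epsilon> > 0" "\<forall>y. (\<Sum>v\<in>V. norm (y v - g v base)) < \<epsilon> \<longrightarrow> (\<exists>z. \<forall>v\<in>V. g v z = y v)"
      using surj[OF inv0] by blast
    define a where "a v = g v base" for v
    obtain P where P: "P \<noteq> 0" "\<forall>s. Q (\<lambda>v. a v + s * (y1 v - a v)) = poly P s"
      using polyfun_on_line_nonzero[of Q V y1 a] Qp y1 by blast
    define n where "n = (\<Sum>v\<in>V. norm (y1 v - a v))"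
    have n: "n \<ge> 0" unfolding n_def by (intro sum_nonneg norm_ge_zero)
    have "infinite ((of_real :: real \<Rightarrow> complex) ` {0<..<\<epsilon> / (n + 1)})"
      using n \<epsilon>(1) by (subst finite_image_iff) (auto simp: inj_on_def infinite_Ioo)
    then have "\<not> (of_real :: real \<Rightarrow> complex) ` {0<..<\<epsilon> / (n + 1)} \<subseteq> {s. poly P s = 0}"
      using poly_roots_finite[OF P(1)] finite_subset by blast
    then obtain s' where s': "s' \<in> (of_real :: real \<Rightarrow> complex) ` {0<..<\<epsilon> / (n + 1)}" "poly P s' \<noteq> 0"
      by blast
    then obtain s where "s' = of_real s" "s \<in> {0<..<\<epsilon> / (n + 1)}" by blast
    with s' have s: "0 < s" "s < \<epsilon> / (n + 1)" "poly P (of_real s) \<noteq> 0" by simp_all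
    have "(\<Sum>v\<in>V. norm ((a v + of_real s * (y1 v - a v)) - g v base)) = s * n"
      using s(1) unfolding n_def a_def by (simp add: norm_mult sum_distrib_left)
    also have "\<dots> \<le> s * (n + 1)" using s(1) by simp
    also have "\<dots> < \<epsilon>" using s(2) n by (simp add: pos_less_divide_eq)
    finally obtain z where z: "\<forall>v\<in>V. g v z = a v + of_real s * (y1 v - a v)"
      using \<epsilon>(2)[rule_format, of "\<lambda>v. a v + of_real s * (y1 v - a v)"] by blast
    have "Q (\<lambda>v. g v z) = Q (\<lambda>v. a v + of_real s * (y1 v - a v))"
      by (rule polyfun_cong[OF Qp]) (use z in blast)
    then have "Q (\<lambda>v. g v z) \<noteq> 0" using s(3) P(2) by simp
    then show ?thesis by blast
  qed
  then obtain z where z: "Q (\<lambda>v. g v z) \<noteq> 0" by blast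
  have "\<exists>x. \<forall>v\<in>V. g v x = y v" if y: "Q y \<noteq> 0" for y
  proof -
    define a where "a v = g v z" for v
    define d where "d v = y v - a v" for v
    define L where "L s = (\<lambda>v. a v + s * d v)" for s
    obtain P where P: "P \<noteq> 0" "\<forall>s. Q (L s) = poly P s"
      using polyfun_on_line_nonzero[of Q V y a] Qp y unfolding L_def d_def by blast
    define W where "W = - {s. poly P s = 0}"
    have fin: "finite {s. poly P s = 0}" by (rule poly_roots_finite[OF P(1)])
    have Wo: "open W" unfolding W_def using finite_imp_closed[OF fin] by (rule open_Compl)
    have Wc: "connected W"
      using connected_open_delete_finite[OF open_UNIV connected_UNIV _ fin]
      unfolding W_def Compl_eq_Diff_UNIV by simp
    have WQ: "s \<in> W \<longleftrightarrow> Q (L s) \<noteq> 0" for s unfolding W_def using P(2) by simp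
    define S where "S = {s \<in> W. \<exists>x. \<forall>v\<in>V. g v x = L s v}"
    have S0: "0 \<in> S"
      unfolding S_def WQ using z by (auto simp: L_def a_def intro!: exI[of _ z])
    have So: "open S"
    proof (subst open_subopen, rule ballI)
      fix s assume s: "s \<in> S"
      then obtain x where x: "\<forall>v\<in>V. g v x = L s v" unfolding S_def by blast
      have "Q (\<lambda>v. g v x) = Q (L s)" by (rule polyfun_cong[OF Qp]) (use x in blast)
      then have "J x \<noteq> 0" using s QJ unfolding S_def WQ by simp
      then obtain B where "mutually_inverse V (\<lambda>v w. q v w x x) B" using J(3) by blast
      then obtain \<epsilon> where \<epsilon>: "\<epsilon> > 0" "\<forall>y. (\<Sum>v\<in>V. norm (y v - g v x)) < \<epsilon> \<longrightarrow> (\<exists>z. \<forall>v\<in>V. g v z = y v)"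
        using surj by blast
      define n where "n = (\<Sum>v\<in>V. norm (d v))"
      have n: "n \<ge> 0" unfolding n_def by (intro sum_nonneg norm_ge_zero)
      obtain r where r: "r > 0" "ball s r \<subseteq> W" using Wo s unfolding S_def open_contains_ball by blast
      have "ball s (min r (\<epsilon> / (n + 1))) \<subseteq> S"
      proof
        fix t assume "t \<in> ball s (min r (\<epsilon> / (n + 1)))"
        then have t: "t \<in> W" "norm (t - s) < \<epsilon> / (n + 1)"
          using r(2) by (auto simp: dist_norm norm_minus_commute)
        have "(\<Sum>v\<in>V. norm (L t v - g v x)) = norm (t - s) * n"
        proof -
          have "norm (L t v - g v x) = norm (t - s) * norm (d v)" if "v \<in> V" for v
          proof -
            have "L t v - g v x = (t - s) * d v" using x that by (simp add: L_def algebra_simps)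
            then show ?thesis by (simp add: norm_mult)
          qed
          then show ?thesis by (simp add: n_def sum_distrib_left)
        qed
        also have "\<dots> \<le> norm (t - s) * (n + 1)" by (intro mult_left_mono) auto
        also have "\<dots> < \<epsilon>" using t(2) n by (simp add: pos_less_divide_eq)
        finally have "\<exists>z. \<forall>v\<in>V. g v z = L t v" using \<epsilon>(2) by blast
        then show "t \<in> S" using t(1) unfolding S_def by blast
      qed
      moreover have "min r (\<epsilon> / (n + 1)) > 0" using r(1) \<epsilon>(1) n by simp
      ultimately show "\<exists>T. open T \<and> s \<in> T \<and> T \<subseteq> S"
        by (intro exI[of _ "ball s (min r (\<epsilon> / (n + 1)))"]) auto
    qed
    have Co: "open (W - S)"
    proof (subst open_subopen, rule ballI)
      fix s assume s: "s \<in> W - S"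
      obtain r where r: "r > 0" "cball s r \<subseteq> W" using Wo s unfolding open_contains_cball by blast
      \<comment> \<open>Near \<open>s\<close> the leading coefficient of the equation for the coordinate \<open>w\<close> is bounded away from
        zero, so the coordinate \<open>w\<close> of all preimages is bounded.\<close>
      have "\<exists>R. \<forall>t\<in>cball s r. \<forall>x. (\<forall>v\<in>V. g v x = L t v) \<longrightarrow> norm (x w) \<le> R" if w: "w \<in> V" for w
      proof -
        have cont: "continuous_on (cball s r) (\<lambda>t. A w k (L t))" for k
          unfolding L_def by (rule polyfun_line_continuous[OF A(1)[OF w]])
        have ne: "cball s r \<noteq> {}" using r(1) by simp
        have "\<exists>t0\<in>cball s r. \<forall>t\<in>cball s r. norm (A w (K w) (L t0)) \<le> norm (A w (K w) (L t))"
          by (rule continuous_attains_inf[OF compact_cball ne continuous_on_norm[OF cont]])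
        then obtain t0 where t0: "t0 \<in> cball s r"
          "\<forall>t\<in>cball s r. norm (A w (K w) (L t0)) \<le> norm (A w (K w) (L t))" by blast
        have "\<exists>t1\<in>cball s r. \<forall>t\<in>cball s r. (\<Sum>k<K w. norm (A w k (L t))) \<le> (\<Sum>k<K w. norm (A w k (L t1)))"
          by (rule continuous_attains_sup[OF compact_cball ne]) (intro continuous_on_sum continuous_on_norm cont)
        then obtain t1 where t1:
          "\<forall>t\<in>cball s r. (\<Sum>k<K w. norm (A w k (L t))) \<le> (\<Sum>k<K w. norm (A w k (L t1)))" by blast
        define M where "M = (\<Sum>k<K w. norm (A w k (L t1)))"
        define \<mu> where "\<mu> = norm (A w (K w) (L t0))"
        have "Q (L t0) \<noteq> 0" using t0(1) r(2) WQ by blast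
        then have \<mu>: "\<mu> > 0" using QA[OF _ w, of "L t0"] unfolding \<mu>_def by simp
        have "norm (x w) \<le> 1 + K w * M / \<mu>" if t: "t \<in> cball s r" and x: "\<forall>v\<in>V. g v x = L t v" for t x
        proof (rule polynomial_root_bound[OF _ \<mu>])
          have "A w k (\<lambda>v. g v x) = A w k (L t)" for k
            by (rule polyfun_cong[OF A(1)[OF w]]) (use x in blast)
          then show "(\<Sum>k\<le>K w. A w k (L t) * x w ^ k) = 0" using A(3)[OF w, of x] by simp
          show "\<mu> \<le> norm (A w (K w) (L t))" using t0(2) t unfolding \<mu>_def by blast
          fix k assume "k < K w"
          then have "norm (A w k (L t)) \<le> (\<Sum>k<K w. norm (A w k (L t)))"
            by (intro member_le_sum[of k "{..<K w}" "\<lambda>k. norm (A w k (L t))"]) auto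
          also have "\<dots> \<le> M" using t1 t unfolding M_def by blast
          finally show "norm (A w k (L t)) \<le> M" .
        qed
        then show ?thesis by blast
      qed
      then have "\<forall>w\<in>V. \<exists>R. \<forall>t\<in>cball s r. \<forall>x. (\<forall>v\<in>V. g v x = L t v) \<longrightarrow> norm (x w) \<le> R" by blast
      then obtain R where R: "\<forall>w\<in>V. \<forall>t\<in>cball s r. \<forall>x. (\<forall>v\<in>V. g v x = L t v) \<longrightarrow> norm (x w) \<le> R w"
        by (rule bchoice[THEN exE])
      \<comment> \<open>The pairs of a parameter \<open>t\<close> near \<open>s\<close> and a preimage of \<open>L t\<close> form a compact set, because
        preimages are bounded once the coordinates outside \<open>V\<close>, on which \<open>g\<close> does not depend, are
        set to zero; its projection is the part of \<open>S\<close> near \<open>s\<close>, which is thus closed.\<close>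
      define Box :: "('v \<Rightarrow> complex) set" where "Box = {x. \<forall>v. x v \<in> cball 0 (if v \<in> V then R v else 0)}"
      define T where "T = (cball s r \<times> Box) \<inter> (\<Inter>v\<in>V. {tx. g v (snd tx) = L (fst tx) v})"
      have "compact T"
        unfolding T_def
      proof (rule compact_Int_closed)
        show "compact (cball s r \<times> Box)" unfolding Box_def by (intro compact_Times compact_cball compact_box)
        show "closed (\<Inter>v\<in>V. {tx. g v (snd tx) = L (fst tx) v})"
        proof (rule closed_INT, rule ballI)
          fix v assume v: "v \<in> V"
          have "continuous_on UNIV (\<lambda>tx :: complex \<times> ('v \<Rightarrow> complex). g v (snd tx))"
            by (rule continuous_on_compose2[OF polyfun_continuous[OF g[OF v]]]) (auto intro: continuous_intros)
          moreover have "continuous_on UNIV (\<lambda>tx :: complex \<times> ('v \<Rightarrow> complex). L (fst tx) v)"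
            unfolding L_def by (intro continuous_intros)
          ultimately show "closed {tx. g v (snd tx) = L (fst tx) v}" by (rule closed_Collect_eq)
        qed
      qed
      then have cl: "closed (fst ` T)"
        by (intro compact_imp_closed compact_continuous_image continuous_intros)
      have TS: "fst ` T = S \<inter> cball s r"
      proof (intro equalityI subsetI)
        fix t assume "t \<in> fst ` T"
        then show "t \<in> S \<inter> cball s r" using r(2) unfolding T_def S_def by auto
      next
        fix t assume t: "t \<in> S \<inter> cball s r"
        then obtain x where x: "\<forall>v\<in>V. g v x = L t v" unfolding S_def by blast
        define x' where "x' v = (if v \<in> V then x v else 0)" for v
        have x': "\<forall>v\<in>V. g v x' = L t v"
          using x polyfun_cong[OF g, of _ x x'] by (simp add: x'_def)
        have "norm (x v) \<le> R v" if "v \<in> V" for v using R t x that by blast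
        then have "x' \<in> Box" unfolding Box_def by (simp add: x'_def)
        then have "(t, x') \<in> T" using t x' unfolding T_def by auto
        then show "t \<in> fst ` T" by force
      qed
      have "ball s r - fst ` T \<subseteq> W - S"
      proof
        fix t assume t: "t \<in> ball s r - fst ` T"
        then have "t \<in> cball s r" by auto
        then show "t \<in> W - S" using t r(2) unfolding TS by blast
      qed
      moreover have "s \<in> ball s r - fst ` T" using s r(1) unfolding TS by auto
      moreover have "open (ball s r - fst ` T)" using cl by (intro open_Diff open_ball)
      ultimately show "\<exists>T. open T \<and> s \<in> T \<and> T \<subseteq> W - S" by blast
    qed
    have "S \<inter> W = {} \<or> (W - S) \<inter> W = {}"
      by (rule connectedD[OF Wc So Co]) auto
    then have "W \<subseteq> S" using S0 unfolding S_def by auto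
    moreover have L1: "L 1 = y" unfolding L_def d_def by (rule ext) simp
    moreover have "1 \<in> W" unfolding WQ L1 using y .
    ultimately show ?thesis unfolding S_def by auto
  qed
  then show ?thesis using Qp Q0 by blast
qed

section \<open>Displacements of Toeplitz commutators\<close>

lemma sum_even_odd: "(\<Sum>j<k. F (2 * j) + F (2 * j + 1)) = (\<Sum>i<2 * k. F i)"
  for F :: "nat \<Rightarrow> 'a :: comm_monoid_add"
  by (induction k) (simp_all add: add_ac)

text \<open>
An entry of the product of the \<open>n \<times> n\<close> Toeplitz matrices with symbols \<open>s\<close> and \<open>t\<close>.
\<close>

definition tprod :: "nat \<Rightarrow> (int \<Rightarrow> complex) \<Rightarrow> (int \<Rightarrow> complex) \<Rightarrow> nat \<Rightarrow> nat \<Rightarrow> complex" where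
  "tprod n s t a b = (\<Sum>l<n. s (int a - int l) * t (int l - int b))"

text \<open>
Passing from \<open>(a, b)\<close> to \<open>(a + 1, b + 1)\<close> shifts the summation index by one, so the difference
consists of the two boundary terms. As a matrix in \<open>(a, b)\<close> it has rank at most two.
\<close>

lemma tprod_displacement:
  "tprod n s t (Suc a) (Suc b) - tprod n s t a b
     = s (int a + 1) * t (- int b - 1) - s (int a + 1 - int n) * t (int n - int b - 1)"
proof -
  define F where "F l = s (int a + 1 - int l) * t (int l - int b - 1)" for l :: nat
  have "tprod n s t (Suc a) (Suc b) = (\<Sum>l<n. F l)"
    unfolding tprod_def F_def by (intro sum.cong refl arg_cong2[where f = "(*)"] arg_cong[where f = s] arg_cong[where f = t]) simp_all
  moreover have "tprod n s t a b = (\<Sum>l<n. F (Suc l))"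
    unfolding tprod_def F_def by (intro sum.cong refl arg_cong2[where f = "(*)"] arg_cong[where f = s] arg_cong[where f = t]) simp_all
  ultimately have "tprod n s t (Suc a) (Suc b) - tprod n s t a b = (\<Sum>l<n. F l - F (Suc l))"
    by (simp add: sum_subtractf)
  also have "\<dots> = F 0 - F n" by (rule sum_lessThan_telescope')
  finally show ?thesis by (simp add: F_def)
qed

text \<open>
The kernel of the displacement operator consists of the Toeplitz matrices.
\<close>

lemma constant_along_diagonals:
  fixes R :: "nat \<Rightarrow> nat \<Rightarrow> complex"
  assumes "\<And>a b. Suc a < n \<Longrightarrow> Suc b < n \<Longrightarrow> R (Suc a) (Suc b) = R a b"
  shows "\<exists>W. \<forall>a<n. \<forall>b<n. R a b = W (int a - int b)"
proof -
  have shift: "R (a + c) (b + c) = R a b" if "a + c < n" "b + c < n" for a b c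
    using that by (induction c) (auto simp: assms)
  have "R a b = R (nat (int a - int b)) (nat (int b - int a))" if "a < n" "b < n" for a b
  proof (cases "a \<le> b")
    case True
    then show ?thesis using shift[of 0 a "b - a"] that by (simp add: nat_diff_distrib)
  next
    case False
    then show ?thesis using shift[of "a - b" b 0] that by (simp add: nat_diff_distrib)
  qed
  then show ?thesis
    by (intro exI[of _ "\<lambda>d. R (nat d) (nat (- d))"]) simp
qed

text \<open>
The symbol of \<open>E\<^sub>j\<close>, with ones on two diagonals. They are chosen so that the boundary vectors of \<open>E\<^sub>j\<close> in
\<open>tprod_displacement\<close> are the standard basis vectors with numbers \<open>2 j\<close> and \<open>2 j + 1\<close>, rows being counted from the
end. The side conditions make a basis vector zero when its number exceeds \<open>n - 2\<close>.
\<close>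

definition toep_dir :: "nat \<Rightarrow> nat \<Rightarrow> int \<Rightarrow> complex" where
  "toep_dir n j d = (if 2 * j + 1 < n \<and> d = int n - 1 - 2 * int j then 1 else 0)
     + (if 2 * j + 2 < n \<and> d = - 2 * int j - 2 then 1 else 0)"

text \<open>
The solution of \<open>C y x + C x (y - 2) = N x y\<close>, where the second term is absent for \<open>y < 2\<close>. The
recursion ends because the sum of the two indices drops by two.
\<close>

function displacement_solution :: "(nat \<Rightarrow> nat \<Rightarrow> complex) \<Rightarrow> nat \<Rightarrow> nat \<Rightarrow> complex" where
  "displacement_solution N x y = N y x - (if x \<ge> 2 then displacement_solution N y (x - 2) else 0)"
  by pat_completeness auto
termination by (relation "measure (\<lambda>(_, x, y). x + y)") auto

declare displacement_solution.simps [simp del]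

text \<open>
Modulo Toeplitz matrices only the displacements \<open>M (a + 1) (b + 1) - M a b\<close> matter. Let \<open>C\<close> be the
matrix whose columns \<open>2 j\<close> and \<open>2 j + 1\<close> are the two boundary vectors of \<open>Z\<^bsub>j+1\<^esub>\<close>, up to sign. Because of
the choice of \<open>E\<^sub>j\<close>, and after reversing the rows, the displacement of the sum has the
entries \<open>C b x + C x (b - 2)\<close>; this system for \<open>C\<close> is triangular. The \<open>n - 1\<close> columns
that are needed are available because \<open>2 (n div 2) \<ge> n - 1\<close>.
\<close>

lemma toeplitz_commutator_decomposition:
  fixes M :: "nat \<Rightarrow> nat \<Rightarrow> complex"
  shows "\<exists>W Z. Z 0 = (\<lambda>_. 0) \<and> (\<forall>a<n. \<forall>b<n. M a b = W (int a - int b)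
     + (\<Sum>j<n div 2. tprod n (Z j) (toep_dir n j) a b - tprod n (toep_dir n j) (Z (Suc j)) a b))"
proof -
  define k where "k = n div 2"
  define N where "N x b = M (Suc (n - 2 - x)) (Suc b) - M (n - 2 - x) b" for x b
  define C where "C = displacement_solution N"
  have C: "C b x + (if b \<ge> 2 then C x (b - 2) else 0) = N x b" for b x
    unfolding C_def by (subst displacement_solution.simps) simp
  \<comment> \<open>The value of the symbol at \<open>0\<close> does not enter the displacement. The case \<open>j = 0\<close> is separate
    since \<open>Z 0\<close> has to vanish.\<close>
  define Z :: "nat \<Rightarrow> int \<Rightarrow> complex" where
    "Z j d = (if j = 0 \<or> d = 0 then 0 else if d < 0 then - C (nat (- 1 - d)) (2 * j - 2)
       else C (nat (int n - 1 - d)) (2 * j - 1))" for j d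
  define T where "T a b = (\<Sum>j<k. tprod n (Z j) (toep_dir n j) a b - tprod n (toep_dir n j) (Z (Suc j)) a b)" for a b
  have "T (Suc a) (Suc b) - T a b = M (Suc a) (Suc b) - M a b" if ab: "Suc a < n" "Suc b < n" for a b
  proof -
    define x where "x = n - 2 - a"
    have x: "x < n - 1" "a = n - 2 - x" "int a = int n - 2 - int x" using ab by (auto simp: x_def)
    \<comment> \<open>The displacement of the summand \<open>j\<close> splits into the contributions \<open>F (2 * j)\<close> and
      \<open>F (2 * j + 1)\<close> of the two boundary terms.\<close>
    define F where "F i = (if b = i then (if i \<ge> 2 then C x (i - 2) else 0) else 0)
        + (if x = i then C b i else 0)" for i
    have e1: "toep_dir n j (- int b - 1) = (if b = 2 * j + 1 then 1 else 0)"
      and e2: "toep_dir n j (int n - int b - 1) = (if b = 2 * j then 1 else 0)"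
      and e3: "toep_dir n j (int a + 1) = (if x = 2 * j then 1 else 0)"
      and e4: "toep_dir n j (int a + 1 - int n) = (if x = 2 * j + 1 then 1 else 0)" for j
      using ab x unfolding toep_dir_def by auto
    have z1: "Z j (int a + 1) = (if j = 0 then 0 else C x (2 * j - 1))" for j
    proof -
      have "nat (int n - 1 - (int a + 1)) = x" using x(3) by simp
      then show ?thesis by (simp add: Z_def)
    qed
    have z2: "Z j (int a + 1 - int n) = (if j = 0 then 0 else - C x (2 * j - 2))" for j
    proof -
      have "nat (- 1 - (int a + 1 - int n)) = x" "int a + 1 - int n < 0" using x(3) by simp_all
      then show ?thesis by (simp add: Z_def)
    qed
    have z3: "Z j (- int b - 1) = (if j = 0 then 0 else - C b (2 * j - 2))" for j
      by (simp add: Z_def)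
    have z4: "Z j (int n - int b - 1) = (if j = 0 then 0 else C b (2 * j - 1))" for j
    proof -
      have "nat (int n - 1 - (int n - int b - 1)) = b" "int n - int b - 1 > 0" using ab by simp_all
      then show ?thesis by (simp add: Z_def)
    qed
    have summand: "(tprod n (Z j) (toep_dir n j) (Suc a) (Suc b) - tprod n (Z j) (toep_dir n j) a b)
       - (tprod n (toep_dir n j) (Z (Suc j)) (Suc a) (Suc b) - tprod n (toep_dir n j) (Z (Suc j)) a b)
       = F (2 * j) + F (2 * j + 1)" for j
      unfolding tprod_displacement e1 e2 e3 e4 z1 z2 z3 z4 F_def by (cases j) auto
    have "T (Suc a) (Suc b) - T a b = (\<Sum>j<k. F (2 * j) + F (2 * j + 1))"
      unfolding T_def summand[symmetric] by (simp add: sum_subtractf)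
    also have "\<dots> = (\<Sum>i<2 * k. F i)" by (rule sum_even_odd)
    also have "\<dots> = (if b \<ge> 2 then C x (b - 2) else 0) + C b x"
    proof -
      have "b < 2 * k" "x < 2 * k" using ab x(1) by (auto simp: k_def)
      then show ?thesis unfolding F_def by (simp add: sum.distrib)
    qed
    also have "\<dots> = N x b" using C[of b x] by (cases "b \<ge> 2") (simp_all add: add.commute)
    also have "\<dots> = M (Suc a) (Suc b) - M a b" using x(2) by (simp add: N_def)
    finally show ?thesis .
  qed
  then have "M (Suc a) (Suc b) - T (Suc a) (Suc b) = M a b - T a b" if "Suc a < n" "Suc b < n" for a b
    using that by (simp add: algebra_simps)
  from constant_along_diagonals[where R = "\<lambda>a b. M a b - T a b", OF this]
  obtain W where "\<forall>a<n. \<forall>b<n. M a b - T a b = W (int a - int b)" by blast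
  then have "\<forall>a<n. \<forall>b<n. M a b = W (int a - int b) + T a b" by (simp add: diff_eq_eq)
  moreover have "Z 0 = (\<lambda>_. 0)" unfolding Z_def by simp
  ultimately show ?thesis unfolding T_def k_def by blast
qed

section \<open>Products of Toeplitz matrices\<close>

text \<open>
The Toeplitz matrix with symbol \<open>t\<close>.
\<close>

definition toep :: "nat \<Rightarrow> (int \<Rightarrow> complex) \<Rightarrow> complex mat" where
  "toep n t = Matrix.mat n n (\<lambda>(i, j). t (int i - int j))"

lemma rho_simps [simp]: "rho n [] = 1\<^sub>m n" "rho n (M # Ms) = M * rho n Ms"
  unfolding rho_def by simp_all

lemma toep_carrier [simp]: "toep n t \<in> carrier_mat n n"
  unfolding toep_def by simp

lemma toep_index [simp]: "i < n \<Longrightarrow> j < n \<Longrightarrow> toep n t $$ (i, j) = t (int i - int j)"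
  unfolding toep_def by simp

lemma toep_mult_index:
  "a < n \<Longrightarrow> b < n \<Longrightarrow> (toep n s * toep n t) $$ (a, b) = tprod n s t a b"
  unfolding tprod_def toep_def by (simp add: scalar_prod_def lessThan_atLeast0)

lemma mat_mult_index:
  fixes A B :: "complex mat"
  assumes "A \<in> carrier_mat n n" "B \<in> carrier_mat n n" "a < n" "b < n"
  shows "(A * B) $$ (a, b) = (\<Sum>c<n. A $$ (a, c) * B $$ (c, b))"
  using assms by (simp add: scalar_prod_def lessThan_atLeast0)

lemma rho_carrier: "set Ms \<subseteq> carrier_mat n n \<Longrightarrow> rho n Ms \<in> carrier_mat n n"
  by (induction Ms) auto

lemma rho_polyfun:
  assumes "\<And>F. F \<in> set Fs \<Longrightarrow> (\<forall>x. F x \<in> carrier_mat n n) \<and> (\<forall>a<n. \<forall>b<n. (\<lambda>x. F x $$ (a, b)) \<in> polyfun X)"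
    and "a < n" "b < n"
  shows "(\<lambda>x. rho n (map (\<lambda>F. F x) Fs) $$ (a, b)) \<in> polyfun X"
  using assms
proof (induction Fs arbitrary: a b)
  case Nil
  then show ?case by (auto intro: polyfun.const)
next
  case (Cons F Fs)
  have F: "F x \<in> carrier_mat n n" "rho n (map (\<lambda>F. F x) Fs) \<in> carrier_mat n n" for x
    using Cons.prems(1) by (auto intro!: rho_carrier)
  have eq: "rho n (map (\<lambda>F. F x) (F # Fs)) $$ (a, b)
      = (\<Sum>c<n. F x $$ (a, c) * rho n (map (\<lambda>F. F x) Fs) $$ (c, b))" for x
    using mat_mult_index[OF F(1) F(2) Cons.prems(2,3)] by simp
  show ?case unfolding eq
  proof (rule polyfun_sum, rule polyfun.mult)
    fix c assume "c \<in> {..<n}"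
    then have c: "c < n" by simp
    show "(\<lambda>x. F x $$ (a, c)) \<in> polyfun X" using Cons.prems(1)[of F] Cons.prems(2) c by simp
    show "(\<lambda>x. rho n (map (\<lambda>F. F x) Fs) $$ (c, b)) \<in> polyfun X"
      by (rule Cons.IH) (use Cons.prems c in auto)
  qed
qed

text \<open>
The differential of the product of the \<open>X\<close> in the directions \<open>Y\<close>.
\<close>

fun dprod :: "nat \<Rightarrow> (complex mat \<times> complex mat) list \<Rightarrow> complex mat" where
  "dprod n [] = 0\<^sub>m n n"
| "dprod n ((X, Y) # l) = Y * rho n (map fst l) + X * dprod n l"

lemma dprod_carrier:
  "set l \<subseteq> carrier_mat n n \<times> carrier_mat n n \<Longrightarrow> dprod n l \<in> carrier_mat n n"
proof (induction l)
  case (Cons p l)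
  obtain X Y where p: "p = (X, Y)" by (cases p)
  have "rho n (map fst l) \<in> carrier_mat n n" using Cons.prems by (intro rho_carrier) auto
  then show ?case using Cons unfolding p by auto
qed simp

lemma rho_has_derivative:
  assumes "set l \<subseteq> carrier_mat n n \<times> carrier_mat n n" "a < n" "b < n"
  shows "((\<lambda>s. rho n (map (\<lambda>(X, Y). X + s \<cdot>\<^sub>m Y) l) $$ (a, b)) has_field_derivative dprod n l $$ (a, b)) (at 0)"
  using assms
proof (induction l arbitrary: a b)
  case Nil
  then show ?case by simp
next
  case (Cons p l)
  obtain X Y where p: "p = (X, Y)" by (cases p)
  have XY: "X \<in> carrier_mat n n" "Y \<in> carrier_mat n n" and l: "set l \<subseteq> carrier_mat n n \<times> carrier_mat n n"
    using Cons.prems(1) unfolding p by auto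
  let ?L = "\<lambda>s. rho n (map (\<lambda>(X, Y). X + s \<cdot>\<^sub>m Y) l)"
  have L: "?L s \<in> carrier_mat n n" for s
    using l by (intro rho_carrier) auto
  have L0: "?L 0 = rho n (map fst l)"
  proof -
    have "map (\<lambda>(X, Y). X + 0 \<cdot>\<^sub>m Y) l = map fst l"
      using l by (intro map_cong refl) (auto intro!: eq_matI)
    then show ?thesis by (rule arg_cong)
  qed
  have dl: "dprod n l \<in> carrier_mat n n" by (rule dprod_carrier[OF l])
  have ml: "rho n (map fst l) \<in> carrier_mat n n" unfolding L0[symmetric] by (rule L)
  have eq: "rho n (map (\<lambda>(X, Y). X + s \<cdot>\<^sub>m Y) (p # l)) $$ (a, b)
      = (\<Sum>c<n. (X $$ (a, c) + s * Y $$ (a, c)) * ?L s $$ (c, b))" for s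
  proof -
    have "(X + s \<cdot>\<^sub>m Y) \<in> carrier_mat n n" using XY by simp
    then have "((X + s \<cdot>\<^sub>m Y) * ?L s) $$ (a, b) = (\<Sum>c<n. (X + s \<cdot>\<^sub>m Y) $$ (a, c) * ?L s $$ (c, b))"
      using L Cons.prems(2,3) by (rule mat_mult_index)
    also have "\<dots> = (\<Sum>c<n. (X $$ (a, c) + s * Y $$ (a, c)) * ?L s $$ (c, b))"
      by (rule sum.cong) (use XY Cons.prems(2) in auto)
    finally show ?thesis unfolding p by simp
  qed
  have "((\<lambda>s. \<Sum>c<n. (X $$ (a, c) + s * Y $$ (a, c)) * ?L s $$ (c, b)) has_field_derivative
      (\<Sum>c<n. Y $$ (a, c) * ?L 0 $$ (c, b) + X $$ (a, c) * dprod n l $$ (c, b))) (at 0)"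
  proof (rule DERIV_sum)
    fix c assume "c \<in> {..<n}"
    then have IH: "((\<lambda>s. ?L s $$ (c, b)) has_field_derivative dprod n l $$ (c, b)) (at 0)"
      by (intro Cons.IH l Cons.prems(3)) simp
    have "((\<lambda>s. X $$ (a, c) + s * Y $$ (a, c)) has_field_derivative Y $$ (a, c)) (at 0)"
      by (auto intro!: derivative_eq_intros)
    from DERIV_mult[OF this IH]
    show "((\<lambda>s. (X $$ (a, c) + s * Y $$ (a, c)) * ?L s $$ (c, b)) has_field_derivative
        Y $$ (a, c) * ?L 0 $$ (c, b) + X $$ (a, c) * dprod n l $$ (c, b)) (at 0)"
      by (simp add: mult.commute)
  qed
  moreover have "(\<Sum>c<n. Y $$ (a, c) * ?L 0 $$ (c, b) + X $$ (a, c) * dprod n l $$ (c, b)) = dprod n (p # l) $$ (a, b)"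
    using XY dl ml Cons.prems(2,3) unfolding L0 p
    by (simp add: sum.distrib mat_mult_index del: index_mult_mat(1))
  ultimately show ?case unfolding eq by simp
qed

text \<open>
The factors from number \<open>i\<close> on, each paired with the direction in which it is varied. The directions
sum to \<open>\<epsilon> W - Z i\<close>, which vanishes for \<open>i = 0\<close>, \<open>Z 0 = 0\<close> and \<open>\<epsilon> = 0\<close>; this makes the differential
divisible by \<open>\<epsilon>\<close>.
\<close>

definition perturbed :: "nat \<Rightarrow> nat \<Rightarrow> (nat \<Rightarrow> complex mat) \<Rightarrow> (nat \<Rightarrow> complex mat) \<Rightarrow>
    complex mat \<Rightarrow> complex \<Rightarrow> nat \<Rightarrow> (complex mat \<times> complex mat) list" where
  "perturbed n k E Z W \<epsilon> i = map (\<lambda>j. (1\<^sub>m n + \<epsilon> \<cdot>\<^sub>m E j, Z (Suc j) - Z j)) [i..<k] @ [(1\<^sub>m n, \<epsilon> \<cdot>\<^sub>m W - Z k)]"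

lemma perturbed_step:
  "i < k \<Longrightarrow> perturbed n k E Z W \<epsilon> i = (1\<^sub>m n + \<epsilon> \<cdot>\<^sub>m E i, Z (Suc i) - Z i) # perturbed n k E Z W \<epsilon> (Suc i)"
  unfolding perturbed_def by (simp add: upt_conv_Cons)

lemma perturbed_carrier:
  assumes "\<And>j. E j \<in> carrier_mat n n" "\<And>j. Z j \<in> carrier_mat n n" "W \<in> carrier_mat n n"
  shows "set (perturbed n k E Z W \<epsilon> i) \<subseteq> carrier_mat n n \<times> carrier_mat n n"
  using assms unfolding perturbed_def by (auto intro!: minus_carrier_mat)

text \<open>
The terms without \<open>\<epsilon>\<close> on the left cancel in pairs, and \<open>IH\<close> turns the others into multiples of \<open>\<epsilon>\<close>.
\<close>

lemma telescoping_step: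
  fixes E Zi Zj S A U :: "complex mat"
  assumes c: "E \<in> carrier_mat n n" "Zi \<in> carrier_mat n n" "Zj \<in> carrier_mat n n" "S \<in> carrier_mat n n"
      "A \<in> carrier_mat n n" "U \<in> carrier_mat n n"
    and IH: "A + Zj * S = \<epsilon> \<cdot>\<^sub>m U"
  shows "((Zj - Zi) * S + (1\<^sub>m n + \<epsilon> \<cdot>\<^sub>m E) * A) + Zi * ((1\<^sub>m n + \<epsilon> \<cdot>\<^sub>m E) * S)
    = \<epsilon> \<cdot>\<^sub>m ((Zi * E - E * Zj) * S + (1\<^sub>m n + \<epsilon> \<cdot>\<^sub>m E) * U)"
proof -
  have X: "(1\<^sub>m n + \<epsilon> \<cdot>\<^sub>m E) * B = B + \<epsilon> \<cdot>\<^sub>m (E * B)" if "B \<in> carrier_mat n n" for B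
    using c that by (simp add: add_mult_distrib_mat[where nr = n and n = n and nc = n] mult_smult_assoc_mat[where nr = n and n = n and nc = n])
  have 1: "(Zj - Zi) * S = Zj * S - Zi * S"
    using c by (simp add: minus_mult_distrib_mat[where nr = n and n = n and nc = n])
  have 2: "Zi * ((1\<^sub>m n + \<epsilon> \<cdot>\<^sub>m E) * S) = Zi * S + \<epsilon> \<cdot>\<^sub>m (Zi * (E * S))"
    unfolding X[OF c(4)] using c by (simp add: mult_add_distrib_mat[where nr = n and n = n and nc = n] mult_smult_distrib[where nr = n and n = n and nc = n])
  have 3: "(Zi * E - E * Zj) * S = Zi * (E * S) - E * (Zj * S)"
    using c by (simp add: minus_mult_distrib_mat[where nr = n and n = n and nc = n] assoc_mult_mat[where n\<^sub>1 = n and n\<^sub>2 = n and n\<^sub>3 = n and n\<^sub>4 = n])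
  have 4: "E * A + E * (Zj * S) = \<epsilon> \<cdot>\<^sub>m (E * U)"
  proof -
    have "E * A + E * (Zj * S) = E * (A + Zj * S)"
      using c by (simp add: mult_add_distrib_mat[where nr = n and n = n and nc = n])
    then show ?thesis unfolding IH using c by (simp add: mult_smult_distrib[where nr = n and n = n and nc = n])
  qed
  have e: "A $$ (a, b) + (Zj * S) $$ (a, b) = \<epsilon> * U $$ (a, b)"
    "(E * A) $$ (a, b) + (E * (Zj * S)) $$ (a, b) = \<epsilon> * (E * U) $$ (a, b)" if "a < n" "b < n" for a b
    using arg_cong[OF IH, of "\<lambda>M. M $$ (a, b)"] arg_cong[OF 4, of "\<lambda>M. M $$ (a, b)"] that c
    by (simp_all del: index_mult_mat(1))
  have alg: "zs - zis + (x + \<epsilon> * ea) + (zis + \<epsilon> * zes) = \<epsilon> * (zes - ezs + (u + \<epsilon> * eu))"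
    if "x + zs = \<epsilon> * u" "ea + ezs = \<epsilon> * eu" for zs zis x ea zes ezs u eu :: complex
  proof -
    have x: "x = \<epsilon> * u - zs" and ea: "ea = \<epsilon> * eu - ezs" using that by (simp_all add: eq_diff_eq)
    show ?thesis unfolding x ea by (simp add: algebra_simps)
  qed
  show ?thesis
    unfolding 1 2 3 X[OF c(5)] X[OF c(6)]
  proof (rule eq_matI)
    fix a b assume "a < dim_row (\<epsilon> \<cdot>\<^sub>m (Zi * (E * S) - E * (Zj * S) + (U + \<epsilon> \<cdot>\<^sub>m (E * U))))"
      "b < dim_col (\<epsilon> \<cdot>\<^sub>m (Zi * (E * S) - E * (Zj * S) + (U + \<epsilon> \<cdot>\<^sub>m (E * U))))"
    then have ab: "a < n" "b < n" using c by auto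
    show "(Zj * S - Zi * S + (A + \<epsilon> \<cdot>\<^sub>m (E * A)) + (Zi * S + \<epsilon> \<cdot>\<^sub>m (Zi * (E * S)))) $$ (a, b)
        = (\<epsilon> \<cdot>\<^sub>m (Zi * (E * S) - E * (Zj * S) + (U + \<epsilon> \<cdot>\<^sub>m (E * U)))) $$ (a, b)"
      using alg[OF e[OF ab]] ab c by (simp del: index_mult_mat(1))
  qed (use c in auto)
qed

text \<open>
Summation by parts from the last factor backwards. The extra summand with \<open>Z i\<close> is the boundary
term that makes the induction work; for \<open>Z 0 = 0\<close> it disappears. That \<open>U\<close> is polynomial in \<open>\<epsilon>\<close> is recorded
by polynomial functions in a single variable, indexed by the type \<open>unit\<close>.
\<close>

lemma perturbed_derivative:
  assumes c: "\<And>j. E j \<in> carrier_mat n n" "\<And>j. Z j \<in> carrier_mat n n" "W \<in> carrier_mat n n"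
    and "i \<le> k"
  shows "\<exists>U. (\<forall>\<epsilon>. U \<epsilon> \<in> carrier_mat n n \<and>
        dprod n (perturbed n k E Z W \<epsilon> i) + Z i * rho n (map fst (perturbed n k E Z W \<epsilon> i)) = \<epsilon> \<cdot>\<^sub>m U \<epsilon>) \<and>
      (\<forall>a<n. \<forall>b<n. (\<lambda>x :: unit \<Rightarrow> complex. U (x ()) $$ (a, b)) \<in> polyfun UNIV) \<and>
      (\<forall>a<n. \<forall>b<n. U 0 $$ (a, b) = W $$ (a, b) + (\<Sum>j\<in>{i..<k}. (Z j * E j) $$ (a, b) - (E j * Z (Suc j)) $$ (a, b)))"
  using \<open>i \<le> k\<close>
proof (induction i rule: inc_induct)
  case base
  have "dprod n (perturbed n k E Z W \<epsilon> k) + Z k * rho n (map fst (perturbed n k E Z W \<epsilon> k)) = \<epsilon> \<cdot>\<^sub>m W" for \<epsilon>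
    unfolding perturbed_def using c(2)[of k] c(3) by (simp, intro eq_matI) auto
  then show ?case using c(3) by (intro exI[of _ "\<lambda>_. W"]) (auto intro: polyfun.const)
next
  case (step i)
  then obtain U where U: "\<And>\<epsilon>. U \<epsilon> \<in> carrier_mat n n"
      "\<And>\<epsilon>. dprod n (perturbed n k E Z W \<epsilon> (Suc i)) + Z (Suc i) * rho n (map fst (perturbed n k E Z W \<epsilon> (Suc i))) = \<epsilon> \<cdot>\<^sub>m U \<epsilon>"
      "\<And>a b. a < n \<Longrightarrow> b < n \<Longrightarrow> (\<lambda>x :: unit \<Rightarrow> complex. U (x ()) $$ (a, b)) \<in> polyfun UNIV"
      "\<And>a b. a < n \<Longrightarrow> b < n \<Longrightarrow> U 0 $$ (a, b) = W $$ (a, b) + (\<Sum>j\<in>{Suc i..<k}. (Z j * E j) $$ (a, b) - (E j * Z (Suc j)) $$ (a, b))"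
    by blast
  define S where "S \<epsilon> = rho n (map fst (perturbed n k E Z W \<epsilon> (Suc i)))" for \<epsilon>
  define D where "D \<epsilon> = dprod n (perturbed n k E Z W \<epsilon> (Suc i))" for \<epsilon>
  have pc: "set (perturbed n k E Z W \<epsilon> (Suc i)) \<subseteq> carrier_mat n n \<times> carrier_mat n n" for \<epsilon>
    by (rule perturbed_carrier[OF c])
  have Sc: "S \<epsilon> \<in> carrier_mat n n" for \<epsilon>
    unfolding S_def using pc[of \<epsilon>] by (intro rho_carrier) auto
  have Dc: "D \<epsilon> \<in> carrier_mat n n" for \<epsilon> unfolding D_def by (rule dprod_carrier[OF pc])
  define K where "K = Z i * E i - E i * Z (Suc i)"
  have Kc: "K \<in> carrier_mat n n" unfolding K_def using c(1)[of i] c(2)[of "Suc i"] by (auto intro!: minus_carrier_mat)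
  define X where "X \<epsilon> = 1\<^sub>m n + \<epsilon> \<cdot>\<^sub>m E i" for \<epsilon>
  have Xc: "X \<epsilon> \<in> carrier_mat n n" for \<epsilon> unfolding X_def using c(1)[of i] by auto
  define U' where "U' \<epsilon> = K * S \<epsilon> + X \<epsilon> * U \<epsilon>" for \<epsilon>
  have Uc: "U' \<epsilon> \<in> carrier_mat n n" for \<epsilon> unfolding U'_def using Kc Sc[of \<epsilon>] Xc[of \<epsilon>] U(1)[of \<epsilon>] by auto
  have main: "dprod n (perturbed n k E Z W \<epsilon> i) + Z i * rho n (map fst (perturbed n k E Z W \<epsilon> i)) = \<epsilon> \<cdot>\<^sub>m U' \<epsilon>" for \<epsilon>
    unfolding perturbed_step[OF step.hyps(2)] dprod.simps list.map fst_conv rho_simps U'_def K_def X_def S_def[symmetric] D_def[symmetric]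
    by (rule telescoping_step[OF c(1) c(2) c(2) Sc Dc U(1)]) (use U(2) in \<open>simp add: S_def D_def\<close>)
  have Xe: "(\<lambda>x :: unit \<Rightarrow> complex. (1\<^sub>m n + x () \<cdot>\<^sub>m E j) $$ (a, b)) \<in> polyfun UNIV" if "a < n" "b < n" for a b j
  proof -
    have eq: "(1\<^sub>m n + x () \<cdot>\<^sub>m E j) $$ (a, b) = 1\<^sub>m n $$ (a, b) + x () * E j $$ (a, b)" for x :: "unit \<Rightarrow> complex"
      using c(1)[of j] that by simp
    show ?thesis unfolding eq by (intro polyfun.add polyfun.mult polyfun.const polyfun.var UNIV_I)
  qed
  have Se: "(\<lambda>x :: unit \<Rightarrow> complex. S (x ()) $$ (a, b)) \<in> polyfun UNIV" if "a < n" "b < n" for a b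
  proof -
    define Fs where "Fs = map (\<lambda>j (x :: unit \<Rightarrow> complex). 1\<^sub>m n + x () \<cdot>\<^sub>m E j) [Suc i..<k] @ [\<lambda>_. 1\<^sub>m n]"
    have "map fst (perturbed n k E Z W (x ()) (Suc i)) = map (\<lambda>F. F x) Fs" for x :: "unit \<Rightarrow> complex"
      unfolding perturbed_def Fs_def by (simp add: comp_def)
    then have eq: "S (x ()) = rho n (map (\<lambda>F. F x) Fs)" for x :: "unit \<Rightarrow> complex"
      unfolding S_def by simp
    show ?thesis unfolding eq
    proof (rule rho_polyfun[OF _ that])
      fix F assume "F \<in> set Fs"
      then consider j where "F = (\<lambda>x. 1\<^sub>m n + x () \<cdot>\<^sub>m E j)" | "F = (\<lambda>_. 1\<^sub>m n)" unfolding Fs_def by auto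
      then show "(\<forall>x. F x \<in> carrier_mat n n) \<and> (\<forall>a<n. \<forall>b<n. (\<lambda>x. F x $$ (a, b)) \<in> polyfun UNIV)"
      proof cases
        case 1
        show ?thesis unfolding 1
        proof (intro conjI allI impI)
          show "1\<^sub>m n + x () \<cdot>\<^sub>m E j \<in> carrier_mat n n" for x :: "unit \<Rightarrow> complex"
            using c(1)[of j] by simp
        qed (rule Xe)
      next
        case 2
        then show ?thesis by (simp add: polyfun.const)
      qed
    qed
  qed
  have poly: "(\<lambda>x :: unit \<Rightarrow> complex. U' (x ()) $$ (a, b)) \<in> polyfun UNIV" if ab: "a < n" "b < n" for a b
  proof -
    have eq: "U' (x ()) $$ (a, b) = (\<Sum>c<n. K $$ (a, c) * S (x ()) $$ (c, b)) + (\<Sum>c<n. X (x ()) $$ (a, c) * U (x ()) $$ (c, b))"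
      for x :: "unit \<Rightarrow> complex"
      unfolding U'_def mat_mult_index[OF Kc Sc ab, symmetric] mat_mult_index[OF Xc U(1) ab, symmetric]
      using ab Kc Sc[of "x ()"] Xc[of "x ()"] U(1)[of "x ()"] by (intro index_add_mat(1)) auto
    show ?thesis unfolding eq
    proof (rule polyfun.add; rule polyfun_sum; rule polyfun.mult)
      fix c assume "c \<in> {..<n}"
      then have c: "c < n" by simp
      show "(\<lambda>x :: unit \<Rightarrow> complex. K $$ (a, c)) \<in> polyfun UNIV" by (rule polyfun.const)
      show "(\<lambda>x :: unit \<Rightarrow> complex. S (x ()) $$ (c, b)) \<in> polyfun UNIV" by (rule Se[OF c ab(2)])
      show "(\<lambda>x :: unit \<Rightarrow> complex. X (x ()) $$ (a, c)) \<in> polyfun UNIV" unfolding X_def by (rule Xe[OF ab(1) c])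
      show "(\<lambda>x :: unit \<Rightarrow> complex. U (x ()) $$ (c, b)) \<in> polyfun UNIV" by (rule U(3)[OF c ab(2)])
    qed
  qed
  have S0: "S 0 = 1\<^sub>m n"
  proof -
    have one: "1\<^sub>m n + 0 \<cdot>\<^sub>m E j = 1\<^sub>m n" for j using c(1)[of j] by (intro eq_matI) auto
    have "rho n (map (\<lambda>j. 1\<^sub>m n) js @ [1\<^sub>m n]) = 1\<^sub>m n" for js :: "nat list"
      by (induction js) auto
    then show ?thesis unfolding S_def perturbed_def by (simp add: comp_def one)
  qed
  have X0: "X 0 = 1\<^sub>m n" unfolding X_def using c(1)[of i] by (intro eq_matI) auto
  have zero: "U' 0 $$ (a, b) = W $$ (a, b) + (\<Sum>j\<in>{i..<k}. (Z j * E j) $$ (a, b) - (E j * Z (Suc j)) $$ (a, b))"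
    if ab: "a < n" "b < n" for a b
  proof -
    have "U' 0 = K + U 0" unfolding U'_def S0 X0 using Kc U(1)[of 0] by simp
    then have "U' 0 $$ (a, b) = K $$ (a, b) + U 0 $$ (a, b)" using ab Kc U(1)[of 0] by simp
    also have "K $$ (a, b) = (Z i * E i) $$ (a, b) - (E i * Z (Suc i)) $$ (a, b)"
      unfolding K_def using ab c(1)[of i] c(2)[of i] c(2)[of "Suc i"] by (simp del: index_mult_mat(1))
    finally show ?thesis
      unfolding U(4)[OF ab] using step.hyps(2) by (simp add: sum.atLeast_Suc_lessThan)
  qed
  show ?case
    by (rule exI[of _ U']) (use Uc main poly zero in blast)
qed

lemma mutually_inverse_identity:
  "finite V \<Longrightarrow> mutually_inverse V (\<lambda>v w. if v = w then 1 else 0) (\<lambda>v w. if v = w then 1 else 0)"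
  unfolding mutually_inverse_def by (simp add: if_distrib[of "\<lambda>c. c * _"] cong: if_cong)

lemma polyfun_unit_nonzero:
  assumes "p \<in> polyfun (UNIV :: unit set)" "p (\<lambda>_. 0) \<noteq> 0"
  shows "\<exists>\<epsilon>. \<epsilon> \<noteq> 0 \<and> p (\<lambda>_. \<epsilon>) \<noteq> 0"
proof -
  obtain P where P: "\<forall>s. p (\<lambda>v. 0 + s * 1) = poly P s"
    using polyfun_on_line[OF assms(1), of "\<lambda>_. 0" "\<lambda>_. 1"] by blast
  have "poly P 0 \<noteq> 0" using P[rule_format, of 0] assms(2) by simp
  then have "P \<noteq> 0" by auto
  then have "finite {s. poly P s = 0}" by (rule poly_roots_finite)
  then have "finite (insert 0 {s. poly P s = 0})" by simp
  then obtain \<epsilon> where "\<epsilon> \<notin> insert 0 {s. poly P s = 0}"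
    using ex_new_if_finite[OF infinite_UNIV_char_0] by blast
  then show ?thesis using P[rule_format, of \<epsilon>] by (intro exI[of _ \<epsilon>]) auto
qed

text \<open>
For each position \<open>v\<close> the decomposition of the matrix unit at \<open>v\<close> provides a direction, and \<open>g\<close> is the
product map restricted to the affine space that these directions span at the base point for a given \<open>\<epsilon>\<close>. Its Jacobian
is \<open>\<epsilon>\<close> times a matrix that is polynomial in \<open>\<epsilon>\<close> and the identity at \<open>\<epsilon> = 0\<close>, hence it is nonsingular
for some \<open>\<epsilon> \<noteq> 0\<close>.
\<close>

theorem generic_toeplitz_product:
  fixes n :: nat
  defines "V \<equiv> {..<n} \<times> {..<n}" and "k \<equiv> n div 2"
  shows "\<exists>Q\<in>polyfun V. (\<exists>y. Q y \<noteq> 0) \<and> (\<forall>y. Q y \<noteq> 0 \<longrightarrow>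
     (\<exists>ts. length ts = Suc k \<and> (\<forall>v\<in>V. rho n (map (toep n) ts) $$ v = y v)))"
proof -
  have V: "finite V" unfolding V_def by simp
  define E where "E j = toep n (toep_dir n j)" for j
  define dec where "dec v WZ \<longleftrightarrow> snd WZ 0 = (\<lambda>_. 0) \<and> (\<forall>a<n. \<forall>b<n. (if (a, b) = v then 1 else 0) = fst WZ (int a - int b)
     + (\<Sum>j<k. tprod n (snd WZ j) (toep_dir n j) a b - tprod n (toep_dir n j) (snd WZ (Suc j)) a b))"
    for v and WZ :: "(int \<Rightarrow> complex) \<times> (nat \<Rightarrow> int \<Rightarrow> complex)"
  have "\<exists>WZ. dec v WZ" for v
  proof -
    obtain W Z where "Z 0 = (\<lambda>_. 0) \<and> (\<forall>a<n. \<forall>b<n. (if (a, b) = v then 1 else 0) = W (int a - int b)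
     + (\<Sum>j<n div 2. tprod n (Z j) (toep_dir n j) a b - tprod n (toep_dir n j) (Z (Suc j)) a b))"
      using toeplitz_commutator_decomposition[of n "\<lambda>a b. if (a, b) = v then 1 else 0"] by blast
    then have "dec v (W, Z)" unfolding dec_def k_def by simp
    then show ?thesis by blast
  qed
  then have "\<forall>v. \<exists>WZ. dec v WZ" by blast
  then obtain WZ where WZ: "\<forall>v. dec v (WZ v)" by (rule choice[THEN exE])
  define ws where "ws v = fst (WZ v)" for v
  define zs where "zs v = snd (WZ v)" for v
  have zs0: "zs v 0 = (\<lambda>_. 0)" for v using WZ unfolding dec_def zs_def by blast
  have unit: "(if (a, b) = v then 1 else 0) = ws v (int a - int b)
     + (\<Sum>j<k. tprod n (zs v j) (toep_dir n j) a b - tprod n (toep_dir n j) (zs v (Suc j)) a b)"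
    if "a < n" "b < n" for v a b using WZ[rule_format, of v] that unfolding dec_def ws_def zs_def by blast
  define pert where "pert v \<epsilon> = perturbed n k E (\<lambda>j. toep n (zs v j)) (toep n (ws v)) \<epsilon> 0" for v \<epsilon>
  define der where "der v U \<longleftrightarrow> (\<forall>\<epsilon>. U \<epsilon> \<in> carrier_mat n n \<and> dprod n (pert v \<epsilon>) = \<epsilon> \<cdot>\<^sub>m U \<epsilon>) \<and>
      (\<forall>a<n. \<forall>b<n. (\<lambda>x :: unit \<Rightarrow> complex. U (x ()) $$ (a, b)) \<in> polyfun UNIV) \<and>
      (\<forall>a<n. \<forall>b<n. U 0 $$ (a, b) = (if (a, b) = v then 1 else 0))" for v U
  have pc: "set (pert v \<epsilon>) \<subseteq> carrier_mat n n \<times> carrier_mat n n" for v \<epsilon>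
    unfolding pert_def by (rule perturbed_carrier) (simp_all add: E_def)
  have "\<exists>U. der v U" for v
  proof -
    obtain U where U: "\<forall>\<epsilon>. U \<epsilon> \<in> carrier_mat n n \<and>
        dprod n (pert v \<epsilon>) + toep n (zs v 0) * rho n (map fst (pert v \<epsilon>)) = \<epsilon> \<cdot>\<^sub>m U \<epsilon>"
      "\<forall>a<n. \<forall>b<n. (\<lambda>x :: unit \<Rightarrow> complex. U (x ()) $$ (a, b)) \<in> polyfun UNIV"
      "\<forall>a<n. \<forall>b<n. U 0 $$ (a, b) = toep n (ws v) $$ (a, b) + (\<Sum>j\<in>{0..<k}. (toep n (zs v j) * E j) $$ (a, b) - (E j * toep n (zs v (Suc j))) $$ (a, b))"
      using perturbed_derivative[of E n "\<lambda>j. toep n (zs v j)" "toep n (ws v)" 0 k]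
      unfolding pert_def[symmetric] by (auto simp: E_def)
    have z: "toep n (zs v 0) = 0\<^sub>m n n" unfolding zs0 by (intro eq_matI) (auto simp: toep_def)
    have "dprod n (pert v \<epsilon>) + toep n (zs v 0) * rho n (map fst (pert v \<epsilon>)) = dprod n (pert v \<epsilon>)" for \<epsilon>
    proof -
      have "rho n (map fst (pert v \<epsilon>)) \<in> carrier_mat n n"
        using pc[of v \<epsilon>] by (intro rho_carrier) auto
      then show ?thesis unfolding z using dprod_carrier[OF pc, of v \<epsilon>] by simp
    qed
    moreover have "U 0 $$ (a, b) = (if (a, b) = v then 1 else 0)" if ab: "a < n" "b < n" for a b
      unfolding unit[OF ab] U(3)[rule_format, OF ab]
      using ab by (simp add: E_def toep_mult_index lessThan_atLeast0 del: index_mult_mat(1))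
    ultimately have "der v U" using U(1,2) unfolding der_def by simp
    then show ?thesis by blast
  qed
  then have "\<forall>v. \<exists>U. der v U" by blast
  then obtain U where U: "\<forall>v. der v (U v)" by (rule choice[THEN exE])
  have Ud: "dprod n (pert v \<epsilon>) = \<epsilon> \<cdot>\<^sub>m U v \<epsilon>" "U v \<epsilon> \<in> carrier_mat n n" for v \<epsilon>
    using U unfolding der_def by blast+
  have Up: "(\<lambda>x :: unit \<Rightarrow> complex. U w (x ()) $$ v) \<in> polyfun UNIV" if "v \<in> V" for v w
    using U[rule_format, of w] that unfolding der_def V_def by (cases v) simp
  have U0: "U w 0 $$ v = (if v = w then 1 else 0)" if "v \<in> V" for v w
    using U[rule_format, of w] that unfolding der_def V_def by (cases v) simp
  have inv0: "mutually_inverse V (\<lambda>v w. U w ((\<lambda>_ :: unit. 0) ()) $$ v) (\<lambda>v w. if v = w then 1 else 0)"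
    using mutually_inverse_identity[OF V] U0 unfolding mutually_inverse_def by simp
  obtain J where J: "J \<in> polyfun (UNIV :: unit set)" "J (\<lambda>_. 0) \<noteq> 0"
      "\<forall>x. J x \<noteq> 0 \<longrightarrow> (\<exists>B. mutually_inverse V (\<lambda>v w. U w (x ()) $$ v) B)"
    using polyfun_matrix_nonsingular[where m = "\<lambda>v w x. U w (x ()) $$ v", OF V Up inv0] by blast
  obtain \<epsilon> where \<epsilon>: "\<epsilon> \<noteq> 0" "J (\<lambda>_. \<epsilon>) \<noteq> 0" using polyfun_unit_nonzero[OF J(1,2)] by blast
  then obtain B where B: "mutually_inverse V (\<lambda>v w. U w \<epsilon> $$ v) B" using J(3)[rule_format, OF \<epsilon>(2)] by blast
  define D where "D v w = \<epsilon> * U w \<epsilon> $$ v" for v w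
  define C where "C v w = B v w / \<epsilon>" for v w
  have DC: "mutually_inverse V D C"
    using B \<epsilon>(1) unfolding mutually_inverse_def D_def C_def by simp
  define \<sigma> where "\<sigma> j z d = (if j < k then (if d = 0 then 1 else 0) + \<epsilon> * toep_dir n j d + (\<Sum>w\<in>V. z w * (zs w (Suc j) d - zs w j d))
      else (if d = 0 then 1 else 0) + (\<Sum>w\<in>V. z w * (\<epsilon> * ws w d - zs w k d)))" for j and z :: "nat \<times> nat \<Rightarrow> complex" and d
  define g where "g v z = rho n (map (\<lambda>j. toep n (\<sigma> j z)) [0..<Suc k]) $$ v" for v z
  have gp: "g v \<in> polyfun V" if "v \<in> V" for v
  proof -
    obtain a b where ab: "v = (a, b)" by (cases v)
    with that have v: "v = (a, b)" "a < n" "b < n" unfolding V_def by auto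
    define Fs where "Fs = map (\<lambda>j z. toep n (\<sigma> j z)) [0..<Suc k]"
    have "g v = (\<lambda>z. rho n (map (\<lambda>F. F z) Fs) $$ (a, b))"
      unfolding g_def v(1) Fs_def by (simp add: comp_def)
    also have "\<dots> \<in> polyfun V"
    proof (rule rho_polyfun[OF _ v(2,3)])
      fix F assume "F \<in> set Fs"
      then obtain j where F: "F = (\<lambda>z. toep n (\<sigma> j z))" unfolding Fs_def by auto
      have "(\<lambda>z. \<sigma> j z d) \<in> polyfun V" for d
        unfolding \<sigma>_def
        by (cases "j < k") (simp_all only: if_True if_False, (intro polyfun.add polyfun_sum polyfun.mult polyfun.const polyfun.var; assumption)+)
      then show "(\<forall>x. F x \<in> carrier_mat n n) \<and> (\<forall>a<n. \<forall>b<n. (\<lambda>x. F x $$ (a, b)) \<in> polyfun V)"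
        unfolding F by simp
    qed
    finally show ?thesis .
  qed
  have gd: "((\<lambda>s. g v ((\<lambda>_. 0)(w := (\<lambda>_. 0) w + s))) has_field_derivative D v w) (at 0)"
    if "v \<in> V" "w \<in> V" for v w
  proof -
    obtain a b where ab: "v = (a, b)" by (cases v)
    with \<open>v \<in> V\<close> have v: "v = (a, b)" "a < n" "b < n" unfolding V_def by auto
    have sum: "(\<Sum>u\<in>V. (if u = w then s else 0) * c u) = s * c w" for s and c :: "nat \<times> nat \<Rightarrow> complex"
    proof -
      have "(\<Sum>u\<in>V. (if u = w then s else 0) * c u) = (\<Sum>u\<in>V. if u = w then s * c w else 0)"
        by (rule sum.cong) auto
      then show ?thesis using V \<open>w \<in> V\<close> by simp
    qed
    have "map (\<lambda>j. toep n (\<sigma> j ((\<lambda>_. 0)(w := s)))) [0..<Suc k] = map (\<lambda>(X, Y). X + s \<cdot>\<^sub>m Y) (pert w \<epsilon>)" for s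
    proof -
      have 1: "toep n (\<sigma> j ((\<lambda>_. 0)(w := s))) = (1\<^sub>m n + \<epsilon> \<cdot>\<^sub>m E j) + s \<cdot>\<^sub>m (toep n (zs w (Suc j)) - toep n (zs w j))"
        if "j < k" for j
        using that unfolding E_def by (intro eq_matI) (auto simp: toep_def \<sigma>_def sum)
      have 2: "toep n (\<sigma> k ((\<lambda>_. 0)(w := s))) = 1\<^sub>m n + s \<cdot>\<^sub>m (\<epsilon> \<cdot>\<^sub>m toep n (ws w) - toep n (zs w k))"
        by (intro eq_matI) (auto simp: toep_def \<sigma>_def sum)
      show ?thesis unfolding pert_def perturbed_def using 1 2 by simp
    qed
    then have "g v ((\<lambda>_. 0)(w := (\<lambda>_. 0) w + s)) = rho n (map (\<lambda>(X, Y). X + s \<cdot>\<^sub>m Y) (pert w \<epsilon>)) $$ (a, b)" for s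
      unfolding g_def v(1) by simp
    moreover have "D v w = dprod n (pert w \<epsilon>) $$ (a, b)"
      unfolding D_def Ud(1) v(1) using Ud(2)[of w \<epsilon>] v(2,3) by simp
    ultimately show ?thesis using rho_has_derivative[OF pc v(2,3), of w \<epsilon>] by simp
  qed
  obtain Q where Q: "Q \<in> polyfun V" "\<exists>y. Q y \<noteq> 0" "\<forall>y. Q y \<noteq> 0 \<longrightarrow> (\<exists>x. \<forall>v\<in>V. g v x = y v)"
    using nonsingular_polymap_generically_surj[where g = g and base = "\<lambda>_. 0" and D = D and C = C, OF V gp gd DC] by blast
  have "\<exists>ts. length ts = Suc k \<and> (\<forall>v\<in>V. rho n (map (toep n) ts) $$ v = y v)" if Qy: "Q y \<noteq> 0" for y
  proof -
    obtain z where "\<forall>v\<in>V. g v z = y v" using Q(3) Qy by blast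
    then show ?thesis unfolding g_def
      by (intro exI[of _ "map (\<lambda>j. \<sigma> j z) [0..<Suc k]"]) (simp add: comp_def)
  qed
  then show ?thesis using Q(1,2) by blast
qed

section \<open>From Toeplitz to Hankel products\<close>

definition exchange :: "nat \<Rightarrow> complex mat" where
  "exchange n = Matrix.mat n n (\<lambda>(i, j). if i + j = n - 1 then 1 else 0)"

lemma exchange_carrier [simp]: "exchange n \<in> carrier_mat n n"
  unfolding exchange_def by simp

lemma mult_exchange_index:
  assumes "A \<in> carrier_mat n n" "i < n" "j < n"
  shows "(A * exchange n) $$ (i, j) = A $$ (i, n - 1 - j)"
    and "(exchange n * A) $$ (i, j) = A $$ (n - 1 - i, j)"
proof -
  have "(A * exchange n) $$ (i, j) = (\<Sum>c<n. if c = n - 1 - j then A $$ (i, n - 1 - j) else 0)"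
    unfolding mat_mult_index[OF assms(1) exchange_carrier assms(2,3)]
    using assms by (intro sum.cong) (auto simp: exchange_def)
  then show "(A * exchange n) $$ (i, j) = A $$ (i, n - 1 - j)" using assms by simp
  have "(exchange n * A) $$ (i, j) = (\<Sum>c<n. if c = n - 1 - i then A $$ (n - 1 - i, j) else 0)"
    unfolding mat_mult_index[OF exchange_carrier assms(1) assms(2,3)]
    using assms by (intro sum.cong) (auto simp: exchange_def)
  then show "(exchange n * A) $$ (i, j) = A $$ (n - 1 - i, j)" using assms by simp
qed

lemma exchange_involution: "exchange n * exchange n = 1\<^sub>m n"
proof (rule eq_matI)
  fix i j assume "i < dim_row (1\<^sub>m n)" "j < dim_col (1\<^sub>m n)"
  then have ij: "i < n" "j < n" by auto
  then show "(exchange n * exchange n) $$ (i, j) = 1\<^sub>m n $$ (i, j)"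
    unfolding mult_exchange_index(1)[OF exchange_carrier ij] by (auto simp: exchange_def)
qed (auto simp: exchange_def)

lemma toep_exchange_Hank: "toep n t * exchange n \<in> Hank n" "exchange n * toep n t \<in> Hank n"
proof -
  have c: "toep n t * exchange n \<in> carrier_mat n n" "exchange n * toep n t \<in> carrier_mat n n"
    using mult_carrier_mat[OF toep_carrier exchange_carrier] mult_carrier_mat[OF exchange_carrier toep_carrier] by blast+
  have 1: "(toep n t * exchange n) $$ (i, j) = t (int i + int j - (int n - 1))"
    and 2: "(exchange n * toep n t) $$ (i, j) = t (int n - 1 - (int i + int j))" if "i < n" "j < n" for i j
    unfolding mult_exchange_index[OF toep_carrier that] using that
    by (auto intro!: arg_cong[where f = t] simp: of_nat_diff)
  have 3: "(toep n t * exchange n) $$ (i, j) = (toep n t * exchange n) $$ (i', j')"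
      "(exchange n * toep n t) $$ (i, j) = (exchange n * toep n t) $$ (i', j')"
    if "i < n" "j < n" "i' < n" "j' < n" "i + j = i' + j'" for i j i' j'
  proof -
    have "int i + int j = int i' + int j'" using that(5) by linarith
    then show "(toep n t * exchange n) $$ (i, j) = (toep n t * exchange n) $$ (i', j')"
      "(exchange n * toep n t) $$ (i, j) = (exchange n * toep n t) $$ (i', j')"
      unfolding 1[OF that(1,2)] 1[OF that(3,4)] 2[OF that(1,2)] 2[OF that(3,4)] by simp_all
  qed
  show "toep n t * exchange n \<in> Hank n" "exchange n * toep n t \<in> Hank n"
    unfolding Hank_def using c 3 by blast+
qed

definition exchange_pow :: "nat \<Rightarrow> nat \<Rightarrow> complex mat" where
  "exchange_pow n r = (if even r then 1\<^sub>m n else exchange n)"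

lemma exchange_pow_carrier [simp]: "exchange_pow n r \<in> carrier_mat n n"
  unfolding exchange_pow_def by simp

lemma exchange_pow_square: "exchange_pow n r * exchange_pow n r = 1\<^sub>m n"
  unfolding exchange_pow_def using exchange_involution by simp

lemma exchange_pow_shift: "exchange_pow n (Suc (Suc r)) = exchange_pow n r"
  unfolding exchange_pow_def by simp

text \<open>
Write \<open>J\<close> for the exchange matrix. The factors of the Hankel product are \<open>S\<^sub>1 J\<close>, \<open>J S\<^sub>2\<close>, \<open>S\<^sub>3 J\<close> and so
on, and adjacent copies of \<open>J\<close> cancel. The second half of the statement is the variant that
starts with \<open>J S\<^sub>1\<close>; each half is the induction hypothesis for the other.
\<close>

lemma toeplitz_product_as_hankel_product:
  "(\<exists>Hs\<in>Hank_tuples n (length ts). rho n Hs = rho n (map (toep n) ts) * exchange_pow n (length ts)) \<and>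
   (\<exists>Hs\<in>Hank_tuples n (length ts). rho n Hs = exchange n * (rho n (map (toep n) ts) * exchange_pow n (Suc (length ts))))"
proof (induction ts)
  case Nil
  have "rho n [] = rho n (map (toep n) []) * exchange_pow n (length [])"
    unfolding exchange_pow_def by simp
  moreover have "rho n [] = exchange n * (rho n (map (toep n) []) * exchange_pow n (Suc (length [])))"
    unfolding exchange_pow_def using exchange_involution left_mult_one_mat[OF exchange_carrier] by simp
  moreover have "[] \<in> Hank_tuples n (length [])" unfolding Hank_tuples_def by simp
  ultimately show ?case by (metis length_0_conv)
next
  case (Cons t ts)
  define P where "P = rho n (map (toep n) ts)"
  have P: "P \<in> carrier_mat n n" unfolding P_def by (intro rho_carrier) auto
  obtain Hs Hs' where Hs: "Hs \<in> Hank_tuples n (length ts)" "rho n Hs = P * exchange_pow n (length ts)"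
    and Hs': "Hs' \<in> Hank_tuples n (length ts)" "rho n Hs' = exchange n * (P * exchange_pow n (Suc (length ts)))"
    using Cons.IH unfolding P_def by blast
  note a = assoc_mult_mat[where n\<^sub>1 = n and n\<^sub>2 = n and n\<^sub>3 = n and n\<^sub>4 = n]
  have PX: "P * exchange_pow n m \<in> carrier_mat n n" for m
    by (rule mult_carrier_mat[OF P exchange_pow_carrier])
  have "rho n ((toep n t * exchange n) # Hs') = toep n t * exchange n * (exchange n * (P * exchange_pow n (Suc (length ts))))"
    unfolding rho_simps(2) Hs'(2) ..
  also have "\<dots> = toep n t * (exchange n * (exchange n * (P * exchange_pow n (Suc (length ts)))))"
    by (rule a) (auto intro: mult_carrier_mat[OF exchange_carrier PX])
  also have "exchange n * (exchange n * (P * exchange_pow n (Suc (length ts)))) = P * exchange_pow n (Suc (length ts))"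
    unfolding a[OF exchange_carrier exchange_carrier PX, symmetric] exchange_involution
    by (rule left_mult_one_mat[OF PX])
  also have "toep n t * (P * exchange_pow n (Suc (length ts))) = rho n (map (toep n) (t # ts)) * exchange_pow n (length (t # ts))"
    using a[OF toep_carrier P exchange_pow_carrier] unfolding P_def by simp
  finally have 1: "rho n ((toep n t * exchange n) # Hs') = rho n (map (toep n) (t # ts)) * exchange_pow n (length (t # ts))" .
  have "rho n ((exchange n * toep n t) # Hs) = exchange n * toep n t * (P * exchange_pow n (length ts))"
    unfolding rho_simps(2) Hs(2) ..
  also have "\<dots> = exchange n * (toep n t * (P * exchange_pow n (length ts)))"
    by (rule a[OF exchange_carrier toep_carrier PX])
  also have "toep n t * (P * exchange_pow n (length ts)) = rho n (map (toep n) (t # ts)) * exchange_pow n (Suc (length (t # ts)))"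
    using a[OF toep_carrier P exchange_pow_carrier] unfolding P_def by (simp add: exchange_pow_shift)
  finally have 2: "rho n ((exchange n * toep n t) # Hs)
      = exchange n * (rho n (map (toep n) (t # ts)) * exchange_pow n (Suc (length (t # ts))))" .
  have "(toep n t * exchange n) # Hs' \<in> Hank_tuples n (length (t # ts))"
    "(exchange n * toep n t) # Hs \<in> Hank_tuples n (length (t # ts))"
    using Hs(1) Hs'(1) toep_exchange_Hank unfolding Hank_tuples_def by auto
  with 1 2 show ?case by blast
qed

text \<open>
If \<open>A J\<^sup>r\<close> is a product of Toeplitz matrices, then \<open>A\<close> is one of \<open>r\<close> Hankel matrices. Multiplication by
\<open>J\<^sup>r\<close> only permutes the entries of \<open>A\<close>, so a polynomial condition on \<open>A J\<^sup>r\<close> is one on \<open>A\<close>. Superfluous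
factors are taken to be the identity, which is Toeplitz.
\<close>

lemma generic_hankel_product:
  assumes r: "r \<ge> n div 2 + 1"
  shows "\<exists>Q\<in>polyfun ({..<n} \<times> {..<n}). (\<exists>y. Q y \<noteq> 0) \<and>
     (\<forall>A\<in>carrier_mat n n. Q (\<lambda>v. A $$ v) \<noteq> 0 \<longrightarrow> (\<exists>Hs\<in>Hank_tuples n r. A = rho n Hs))"
proof -
  let ?V = "{..<n} \<times> {..<n}"
  obtain Q where Q: "Q \<in> polyfun ?V" "\<exists>y. Q y \<noteq> 0" "\<forall>y. Q y \<noteq> 0 \<longrightarrow>
     (\<exists>ts. length ts = Suc (n div 2) \<and> (\<forall>v\<in>?V. rho n (map (toep n) ts) $$ v = y v))"
    using generic_toeplitz_product[of n] by blast
  define \<sigma> where "\<sigma> v = (if even r then v else (fst v, n - 1 - snd v))" for v :: "nat \<times> nat"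
  have \<sigma>V: "\<sigma> v \<in> ?V" "\<sigma> (\<sigma> v) = v" if "v \<in> ?V" for v
    using that unfolding \<sigma>_def by auto
  define Q' where "Q' y = Q (\<lambda>v. y (\<sigma> v))" for y
  have "(\<lambda>y. Q (\<lambda>v. y (\<sigma> v))) \<in> polyfun ?V"
    by (rule polyfun_subst[where p = Q and V = ?V and g = "\<lambda>v y. y (\<sigma> v)", OF Q(1)]) (rule polyfun.var[OF \<sigma>V(1)])
  then have "Q' \<in> polyfun ?V" unfolding Q'_def .
  moreover have "\<exists>y. Q' y \<noteq> 0"
  proof -
    obtain y where y: "Q y \<noteq> 0" using Q(2) by blast
    have "Q (\<lambda>v. y (\<sigma> (\<sigma> v))) = Q y" by (rule polyfun_cong[OF Q(1)]) (simp only: \<sigma>V(2))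
    then show ?thesis using y unfolding Q'_def by (intro exI[of _ "\<lambda>v. y (\<sigma> v)"]) simp
  qed
  moreover have "\<exists>Hs\<in>Hank_tuples n r. A = rho n Hs"
    if A: "A \<in> carrier_mat n n" and QA: "Q' (\<lambda>v. A $$ v) \<noteq> 0" for A
  proof -
    define B where "B = A * exchange_pow n r"
    have Bc: "B \<in> carrier_mat n n" unfolding B_def using A by (rule mult_carrier_mat) simp
    have Be: "B $$ v = A $$ \<sigma> v" if "v \<in> ?V" for v
    proof -
      obtain i j where v: "v = (i, j)" by (cases v)
      with that have ij: "i < n" "j < n" by auto
      show ?thesis unfolding v B_def exchange_pow_def \<sigma>_def
        using mult_exchange_index(1)[OF A ij] right_mult_one_mat[OF A] by simp
    qed
    obtain ts where ts: "length ts = Suc (n div 2)" "\<forall>v\<in>?V. rho n (map (toep n) ts) $$ v = A $$ \<sigma> v"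
      using Q(3) QA unfolding Q'_def by blast
    define us where "us = ts @ replicate (r - length ts) (\<lambda>d. if d = 0 then 1 else 0)"
    have len: "length us = r" unfolding us_def using ts(1) r by simp
    have one: "toep n (\<lambda>d. if d = 0 then 1 else 0) = 1\<^sub>m n" by (intro eq_matI) (auto simp: toep_def)
    have ones: "rho n (replicate m (1\<^sub>m n)) = 1\<^sub>m n" for m by (induction m) simp_all
    have app: "rho n (map (toep n) ts @ replicate m (1\<^sub>m n)) = rho n (map (toep n) ts)" for m ts
      by (induction ts) (simp_all add: ones)
    have "rho n (map (toep n) us) = rho n (map (toep n) ts)"
      unfolding us_def map_append map_replicate one by (rule app)
    also have "\<dots> = B"
    proof (rule eq_matI)
      fix i j assume "i < dim_row B" "j < dim_col B"
      then have "(i, j) \<in> ?V" using Bc by auto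
      then show "rho n (map (toep n) ts) $$ (i, j) = B $$ (i, j)" using ts(2) Be by simp
    next
      have "rho n (map (toep n) ts) \<in> carrier_mat n n" by (intro rho_carrier) auto
      then show "dim_row (rho n (map (toep n) ts)) = dim_row B" "dim_col (rho n (map (toep n) ts)) = dim_col B"
        using Bc by auto
    qed
    finally have P: "rho n (map (toep n) us) = B" .
    obtain Hs where Hs: "Hs \<in> Hank_tuples n r" "rho n Hs = B * exchange_pow n r"
      using toeplitz_product_as_hankel_product[of n us] unfolding len P by blast
    have "B * exchange_pow n r = A"
      unfolding B_def using assoc_mult_mat[OF A exchange_pow_carrier exchange_pow_carrier, of r r] exchange_pow_square right_mult_one_mat[OF A] by simp
    then show ?thesis using Hs by metis
  qed
  ultimately show ?thesis by blast
qed

section \<open>Zariski closures\<close>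

lemma eval_entries_superset:
  assumes "finite F" "Poly_Mapping.keys p \<subseteq> F"
  shows "eval_entries p A = (\<Sum>m\<in>F. Poly_Mapping.lookup p m * (\<Prod>v\<in>Poly_Mapping.keys m. (A $$ v) ^ Poly_Mapping.lookup m v))"
  unfolding eval_entries_def
  by (rule sum.mono_neutral_left[OF assms]) (simp add: in_keys_iff)

lemma eval_entries_add: "eval_entries (p + q) A = eval_entries p A + eval_entries q A"
proof -
  let ?F = "Poly_Mapping.keys p \<union> Poly_Mapping.keys q"
  have F: "finite ?F" by simp
  show ?thesis
    unfolding eval_entries_superset[OF F Poly_Mapping.keys_add[of p q]]
      eval_entries_superset[OF F Un_upper1] eval_entries_superset[OF F Un_upper2]
    by (simp add: lookup_add distrib_right sum.distrib)
qed

lemma eval_entries_sum: "eval_entries (\<Sum>i\<in>I. p i) A = (\<Sum>i\<in>I. eval_entries (p i) A)"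
  by (induction I rule: infinite_finite_induct) (simp_all add: eval_entries_add, simp_all add: eval_entries_def)

lemma entry_polys_sum: "(\<And>i. i \<in> I \<Longrightarrow> p i \<in> entry_polys n) \<Longrightarrow> (\<Sum>i\<in>I. p i) \<in> entry_polys n"
proof (induction I rule: infinite_finite_induct)
  case (insert i I)
  then show ?case using Poly_Mapping.keys_add[of "p i" "sum p I"] unfolding entry_polys_def by auto
qed (simp_all add: entry_polys_def)

text \<open>
Expanding \<open>q\<close> into monomials first means that only the additivity of the evaluation is needed.
\<close>

lemma polyfun_is_eval_entries:
  assumes "q \<in> polyfun ({..<n} \<times> {..<n})"
  shows "\<exists>p\<in>entry_polys n. \<forall>A. eval_entries p A = q (\<lambda>v. A $$ v)"
proof -
  let ?V = "{..<n} \<times> {..<n}"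
  have V: "finite ?V" by simp
  obtain d where "coord_degree_le ?V d q" using polyfun_coord_degree_le[OF V assms] by blast
  then obtain c where c: "\<forall>x. q x = (\<Sum>a\<in>exponents ?V d. c a * power_product ?V a x)" unfolding coord_degree_le_def by blast
  define ex where "ex a = (\<Sum>v\<in>?V. Poly_Mapping.single v (a v))" for a :: "nat \<times> nat \<Rightarrow> nat"
  have lookup: "Poly_Mapping.lookup (ex a) v = (if v \<in> ?V then a v else 0)" for a v
  proof -
    have "Poly_Mapping.lookup (ex a) v = (\<Sum>u\<in>?V. if u = v then a v else 0)"
      unfolding ex_def lookup_sum by (rule sum.cong) (auto simp: lookup_single when_def)
    then show ?thesis using V by simp
  qed
  have keys: "Poly_Mapping.keys (ex a) \<subseteq> ?V" for a
    using lookup[of a] by (auto simp: in_keys_iff split: if_splits)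
  define mono_poly where "mono_poly a = Poly_Mapping.single (ex a) (c a)" for a
  have "mono_poly a \<in> entry_polys n" for a
    using keys[of a] unfolding mono_poly_def entry_polys_def by auto
  then have "(\<Sum>a\<in>exponents ?V d. mono_poly a) \<in> entry_polys n" by (intro entry_polys_sum)
  moreover have "eval_entries (mono_poly a) A = c a * power_product ?V a (\<lambda>v. A $$ v)" for a A
  proof -
    have "eval_entries (mono_poly a) A = c a * (\<Prod>v\<in>Poly_Mapping.keys (ex a). (A $$ v) ^ Poly_Mapping.lookup (ex a) v)"
      unfolding mono_poly_def by (subst eval_entries_superset[of "{ex a}"]) (auto simp: lookup_single)
    also have "(\<Prod>v\<in>Poly_Mapping.keys (ex a). (A $$ v) ^ Poly_Mapping.lookup (ex a) v) = (\<Prod>v\<in>?V. (A $$ v) ^ Poly_Mapping.lookup (ex a) v)"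
      by (rule prod.mono_neutral_left[OF V keys]) (simp add: in_keys_iff)
    also have "\<dots> = power_product ?V a (\<lambda>v. A $$ v)"
      unfolding power_product_def by (rule prod.cong) (simp_all add: lookup)
    finally show ?thesis .
  qed
  ultimately show ?thesis using c
    by (intro bexI[of _ "\<Sum>a\<in>exponents ?V d. mono_poly a"]) (simp_all add: eval_entries_sum)
qed

lemma eval_entries_is_polyfun:
  assumes "p \<in> entry_polys n"
  shows "\<exists>q\<in>polyfun ({..<n} \<times> {..<n}). \<forall>A. eval_entries p A = q (\<lambda>v. A $$ v)"
proof
  show "(\<lambda>x. \<Sum>m\<in>Poly_Mapping.keys p. Poly_Mapping.lookup p m *
        (\<Prod>v\<in>Poly_Mapping.keys m. x v ^ Poly_Mapping.lookup m v)) \<in> polyfun ({..<n} \<times> {..<n})"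
    using assms unfolding entry_polys_def
    by (intro polyfun_sum polyfun.mult polyfun.const polyfun_prod polyfun_power polyfun.var) blast
qed (simp add: eval_entries_def)

lemma zariski_closed_carrier: "zariski_closed n (carrier_mat n n)"
  unfolding zariski_closed_def by (intro exI[of _ "{}"]) simp

lemma ex_matrix_with_entries:
  assumes "Q \<in> polyfun ({..<n} \<times> {..<n})"
  shows "\<exists>A\<in>carrier_mat n n. Q (\<lambda>v. A $$ v) = Q y"
proof
  show "Matrix.mat n n y \<in> carrier_mat n n" by simp
  show "Q (\<lambda>v. Matrix.mat n n y $$ v) = Q y" by (rule polyfun_cong[OF assms]) auto
qed

text \<open>
A polynomial \<open>q\<close> that vanishes on \<open>S\<close> satisfies \<open>q Q = 0\<close> everywhere, hence \<open>q = 0\<close>.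
\<close>

lemma contains_principal_open_imp_dense:
  assumes Q: "Q \<in> polyfun ({..<n} \<times> {..<n})" "Q y \<noteq> 0"
    and S: "S \<subseteq> carrier_mat n n" "\<And>A. A \<in> carrier_mat n n \<Longrightarrow> Q (\<lambda>v. A $$ v) \<noteq> 0 \<Longrightarrow> A \<in> S"
  shows "zariski_closure n S = carrier_mat n n"
proof
  show "zariski_closure n S \<subseteq> carrier_mat n n"
    unfolding zariski_closure_def by (rule hull_minimal[OF S(1)]) (rule zariski_closed_carrier)
  have "carrier_mat n n \<subseteq> Z" if SZ: "S \<subseteq> Z" and "zariski_closed n Z" for Z
  proof
    obtain P where P: "P \<subseteq> entry_polys n" "Z = {A \<in> carrier_mat n n. \<forall>p\<in>P. eval_entries p A = 0}"
      using \<open>zariski_closed n Z\<close> unfolding zariski_closed_def by blast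
    fix A :: "complex mat" assume A: "A \<in> carrier_mat n n"
    have "eval_entries p A = 0" if "p \<in> P" for p
    proof (rule ccontr)
      assume ne: "eval_entries p A \<noteq> 0"
      obtain q where q: "q \<in> polyfun ({..<n} \<times> {..<n})" "\<forall>A. eval_entries p A = q (\<lambda>v. A $$ v)"
        using eval_entries_is_polyfun P(1) \<open>p \<in> P\<close> by blast
      have "\<exists>z. q z * Q z \<noteq> 0"
        by (rule polyfun_mult_nonzero[where p = q and q = Q and x = "\<lambda>v. A $$ v" and y = y, OF q(1) Q(1) _ Q(2)])
          (use ne q(2) in simp)
      then obtain z where z: "q z * Q z \<noteq> 0" by blast
      have "(\<lambda>z. q z * Q z) \<in> polyfun ({..<n} \<times> {..<n})" using q(1) Q(1) by (rule polyfun.mult)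
      from ex_matrix_with_entries[OF this, of z] obtain B where
        B: "B \<in> carrier_mat n n" "q (\<lambda>v. B $$ v) * Q (\<lambda>v. B $$ v) = q z * Q z" by blast
      then have "Q (\<lambda>v. B $$ v) \<noteq> 0" "q (\<lambda>v. B $$ v) \<noteq> 0" using z by auto
      then have "B \<in> Z" "eval_entries p B \<noteq> 0" using S(2)[OF B(1)] SZ q(2) by auto
      then show False using P(2) \<open>p \<in> P\<close> by blast
    qed
    then show "A \<in> Z" using A P(2) by blast
  qed
  then show "carrier_mat n n \<subseteq> zariski_closure n S"
    unfolding zariski_closure_def hull_def by blast
qed

lemma contains_principal_open_imp_generic:
  assumes Q: "Q \<in> polyfun ({..<n} \<times> {..<n})" "Q y \<noteq> 0"
    and P: "\<And>A. A \<in> carrier_mat n n \<Longrightarrow> Q (\<lambda>v. A $$ v) \<noteq> 0 \<Longrightarrow> P A"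
  shows "generic n P"
proof -
  obtain p where p: "p \<in> entry_polys n" "\<forall>A. eval_entries p A = Q (\<lambda>v. A $$ v)"
    using polyfun_is_eval_entries[OF Q(1)] by blast
  define Z where "Z = {A \<in> carrier_mat n n. eval_entries p A = 0}"
  have "zariski_closed n Z"
    unfolding zariski_closed_def Z_def using p(1) by (intro exI[of _ "{p}"]) simp
  then have "zariski_closure n {A \<in> carrier_mat n n. \<not> P A} \<subseteq> Z"
    unfolding zariski_closure_def by (intro hull_minimal) (use P p(2) in \<open>auto simp: Z_def\<close>)
  moreover obtain B where "B \<in> carrier_mat n n" "Q (\<lambda>v. B $$ v) = Q y"
    using ex_matrix_with_entries[OF Q(1)] by blast
  then have "B \<in> carrier_mat n n - Z" using Q(2) p(2) unfolding Z_def by simp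
  moreover have "Z \<subseteq> carrier_mat n n" unfolding Z_def by blast
  ultimately show ?thesis unfolding generic_def by blast
qed

lemma rho_Hank_tuples_carrier: "Hs \<in> Hank_tuples n r \<Longrightarrow> rho n Hs \<in> carrier_mat n n"
  using rho_carrier[of Hs n] unfolding Hank_tuples_def Hank_def by blast

theorem theorem4p3:
  fixes n :: nat
  assumes "n \<ge> 1"
  shows "(\<forall>r::nat. r \<ge> 1 \<longrightarrow> r \<ge> n div 2 + 1 \<longrightarrow> dominant n (Hank_tuples n r) (rho n)) \<and>
         generic n (\<lambda>A. \<exists>Hs \<in> Hank_tuples n (n div 2 + 1). A = rho n Hs)"
proof (intro conjI allI impI)
  fix r :: nat assume r: "r \<ge> n div 2 + 1"
  obtain Q y where Q: "Q \<in> polyfun ({..<n} \<times> {..<n})" "Q y \<noteq> 0"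
    "\<forall>A\<in>carrier_mat n n. Q (\<lambda>v. A $$ v) \<noteq> 0 \<longrightarrow> (\<exists>Hs\<in>Hank_tuples n r. A = rho n Hs)"
    using generic_hankel_product[OF r] by blast
  have im: "rho n ` Hank_tuples n r \<subseteq> carrier_mat n n" using rho_Hank_tuples_carrier by blast
  show "dominant n (Hank_tuples n r) (rho n)"
    unfolding dominant_def
    using contains_principal_open_imp_dense[OF Q(1,2) im] Q(3) im by blast
next
  obtain Q y where Q: "Q \<in> polyfun ({..<n} \<times> {..<n})" "Q y \<noteq> 0"
    "\<forall>A\<in>carrier_mat n n. Q (\<lambda>v. A $$ v) \<noteq> 0 \<longrightarrow> (\<exists>Hs\<in>Hank_tuples n (n div 2 + 1). A = rho n Hs)"
    using generic_hankel_product[of n "n div 2 + 1"] by blast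
  then show "generic n (\<lambda>A. \<exists>Hs \<in> Hank_tuples n (n div 2 + 1). A = rho n Hs)"
    by (intro contains_principal_open_imp_generic[OF Q(1,2)]) blast
qed

end
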